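(* Consider a panel with $i=1,\dots,N$ and $t=1,\dots,T$ generated by $$Y_{it}=X_{it}'\beta^0+\Gamma_{it}+\varepsilon_{it},$$ where $X_{it}=(X_{it,1},\dots,X_{it,K})'\in\mathbb{R}^K$ is observed, $\beta^0\in\mathbb{R}^K$ is the true parameter, and the $N\times T$ matrices $\Gamma=(\Gamma_{it})$ and $\varepsilon=(\varepsilon_{it})$ are unobserved (arbitrary dependence between $X$ and $\Gamma$ is allowed). Let $R_{NT}$ be a sequence of positive integers and let $\widehat\beta_{\rm LS}$ be the least-squares interactive fixed effects estimator computed with $R=R_{NT}$ factors. Suppose the following hold as $N,T\to\infty$: (1) $\frac1{NT}\sum_{i=1}^N\sum_{t=1}^T X_{it,k}^2=O_P(1)$ for $k=1,\dots,K$, and $\|\varepsilon\|=O_P(\sqrt{\max\{N,T\}})$; (2) $\sum_{i=1}^N\sum_{t=1}^T X_{it,k}\varepsilon_{it}=O_P(\sqrt{NT})$ for $k=1,\dots,K$; (3) there is a constant $b>0$ such that, with probability approaching one, $$\min_{\delta\in\mathbb{R}^K,\ \|\delta\|=1}\ \sum_{r=2R_{NT}+1}^{\min(N,T)}\sigma_r^2\!\left[\frac{\delta\cdot X}{\sqrt{NT}}\right]\ \ge\ b,$$ where $\delta\cdot X=\sum_{k=1}^K\delta_kX_k$; (4) there is a constant $\rho>3/2$ such that $\frac1{NT}\sum_{r=R_{NT}+1}^{\min(N,T)}\sigma_r^2(\Gamma)=O_P(R_{NT}^{1-2\rho})$. Assume moreover that $R_{NT}=o(\min\{N,T\})$. Then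 $$\widehat\beta_{\rm LS}-\beta^0=O_P\big(R_{NT}^{(3-2\rho)/2}\big)+O_P\big(R_{NT}(\min\{N,T\})^{-1/2}\big).$$ Consequently, choosing $R_{NT}\propto(\min\{N,T\})^{1/(2\rho-1)}$ gives $$\widehat\beta_{\rm LS}-\beta^0=O_P\Big(\min\{N,T\}^{\frac{3-2\rho}{2(2\rho-1)}}\Big).$$
   Context: $X_k$ denotes the $N\times T$ matrix $(X_{it,k})$. For a matrix $A$, $\sigma_r(A)$ is its $r$-th largest singular value and $\|A\|$ its spectral norm; $\|\delta\|$ is the Euclidean norm of a vector. The least-squares interactive fixed effects estimator with $R$ factors is $$\widehat\beta_{\rm LS}\in\operatorname*{argmin}_{\beta\in\mathbb{R}^K}\ \min_{\lambda\in\mathbb{R}^{N\times R},\,f\in\mathbb{R}^{T\times R}}\ \sum_{i=1}^N\sum_{t=1}^T\Big(Y_{it}-X_{it}'\beta-\sum_{r=1}^R\lambda_{ir}f_{tr}\Big)^2.$$ "With probability approaching one" (wpa1) means with probability tending to one as $N,T\to\infty$. *)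

theory Defs
  imports "HOL-Probability.Probability" "HOL-Library.Landau_Symbols"
          "Jordan_Normal_Form.Char_Poly"
begin

definition to_mat :: "nat \<Rightarrow> nat \<Rightarrow> (nat \<Rightarrow> nat \<Rightarrow> real) \<Rightarrow> real mat" where
  "to_mat N T A = mat N T (\<lambda>(i, t). A i t)"

text \<open>Eigenvalues of A A' (with multiplicity), in decreasing order;
  these are the squared singular values of A (padded with zeros).\<close>
definition sq_singular_values :: "real mat \<Rightarrow> real list" where
  "sq_singular_values A =
     rev (sorted_list_of_multiset (proots (char_poly (A * transpose_mat A))))"

definition sing_val :: "nat \<Rightarrow> real mat \<Rightarrow> real" where
  "sing_val r A = sqrt (sq_singular_values A ! (r - 1))"

definition spec_norm :: "real mat \<Rightarrow> real" where
  "spec_norm A = sing_val 1 A"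

definition outer_prob :: "'a measure \<Rightarrow> 'a set \<Rightarrow> real" where
  "outer_prob M A = Inf {measure M B | B. B \<in> sets M \<and> A \<inter> space M \<subseteq> B}"

definition inner_prob :: "'a measure \<Rightarrow> 'a set \<Rightarrow> real" where
  "inner_prob M A = Sup {measure M B | B. B \<in> sets M \<and> B \<subseteq> A}"

definition bigO_P :: "'i filter \<Rightarrow> ('i \<Rightarrow> 'a measure) \<Rightarrow> ('i \<Rightarrow> 'a \<Rightarrow> real) \<Rightarrow> ('i \<Rightarrow> real) \<Rightarrow> bool" where
  "bigO_P F M Z a \<longleftrightarrow>
     (\<forall>eps > 0. \<exists>C. eventually (\<lambda>n. outer_prob (M n) {\<omega> \<in> space (M n). \<bar>Z n \<omega>\<bar> > C * a n} < eps) F)"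

definition wpa1 :: "'i filter \<Rightarrow> ('i \<Rightarrow> 'a measure) \<Rightarrow> ('i \<Rightarrow> 'a \<Rightarrow> bool) \<Rightarrow> bool" where
  "wpa1 F M E \<longleftrightarrow> ((\<lambda>n. inner_prob (M n) {\<omega> \<in> space (M n). E n \<omega>}) \<longlongrightarrow> 1) F"

definition LS_obj :: "nat \<Rightarrow> nat \<Rightarrow> nat \<Rightarrow> (nat \<Rightarrow> nat \<Rightarrow> real) \<Rightarrow> (nat \<Rightarrow> nat \<Rightarrow> real^'k)
                      \<Rightarrow> real^'k \<Rightarrow> real" where
  "LS_obj N T R Y X \<beta> =
     Inf {(\<Sum>i<N. \<Sum>t<T. (Y i t - X i t \<bullet> \<beta> - (\<Sum>r<R. lam i r * f t r))\<^sup>2)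
          | lam f :: nat \<Rightarrow> nat \<Rightarrow> real. True}"

end

(*
Write delta for the estimation error and Gamma = Gamma_1 + Gamma_2 with Gamma_1 the best
rank-R approximation of Gamma.  Comparing the least-squares objective at the estimator
(with near-optimal factors L) and at the true parameter (with factors Gamma_1) gives, for
V = delta.X + (L - Gamma_1),
    |V|^2 <= 2 <Gamma_2, V> + 2 <delta.X, eps> + 2 <L - Gamma_1, eps>
up to an arbitrarily small error.  Since L - Gamma_1 has rank at most 2R, Eckart-Young and
condition (3) give |V| >= |delta| sqrt(b N T), and the last inner product is at most
sqrt(2R) ||eps|| |L - Gamma_1|.  Hence |V| is bounded by a constant times
|Gamma_2| + 1 + sqrt(R max(N,T)) on an event of large probability.  Dividing by sqrt(N T)
yields the rate R^((1-2 rho)/2) + sqrt(R / min(N,T)), which is at most the claimed one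
because R >= 1.
*)
theory Submission
  imports Defs
begin

section \<open>Orthogonal diagonalization of real symmetric matrices\<close>

text \<open>\<open>sing_val\<close> is read off the roots of a characteristic polynomial, so the
  spectral theorem, an SVD and both halves of Eckart-Young are derived before any statistics. The
  noise is split along V because Cauchy-Schwarz on <eps, V> would cost the Frobenius norm of eps,
  which (1) bounds only by the order sqrt(N T); a rank-2R factor pays just sqrt(2R) times the
  spectral norm. That factor L - Gamma_1 is not V itself: its norm is at most |V| + |delta.X|, and
  |delta.X| is returned to |V| by the second-moment half of (1) together with (3). All terms on the
  right are then linear in |V|, one power of |V| cancels, and no consistency argument has to precede
  the rate. The arbitrarily small error is there because \<open>LS_obj\<close> is an infimum.
  Probability enters only at the end: the deterministic bound holds off five exceptional sets, whose
  outer probabilities add up.\<close>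

lemma mult_mat_index: "A \<in> carrier_mat n m \<Longrightarrow> B \<in> carrier_mat m k \<Longrightarrow> i < n \<Longrightarrow> j < k \<Longrightarrow>
  (A * B) $$ (i,j) = (\<Sum>l<m. A $$ (i,l) * B $$ (l,j))"
  by (auto simp: scalar_prod_def atLeast0LessThan)

text \<open>Over the complex numbers the characteristic polynomial splits, so an eigenvector v
  exists. For a real symmetric matrix the form v* C v equals its own conjugate, which forces the
  eigenvalue to be real.\<close>

lemma real_symmetric_eigenvalue_exists:
  fixes A :: "real mat"
  assumes A: "A \<in> carrier_mat n n" and sym: "transpose_mat A = A" and n: "n > 0"
  shows "\<exists>l. eigenvalue A l"
proof -
  define C where "C = map_mat complex_of_real A"
  have C: "C \<in> carrier_mat n n" using A by (auto simp: C_def)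
  obtain as where as: "char_poly C = (\<Prod>a\<leftarrow>as. [:- a, 1:])" and len: "length as = n"
    using char_poly_factorized[OF C] by auto
  obtain \<mu> where "\<mu> \<in> set as" using len n by (cases as) auto
  then have root: "poly (char_poly C) \<mu> = 0"
    unfolding as by (auto simp: poly_prod_list prod_list_zero_iff)
  then obtain v where "eigenvector C v \<mu>"
    using eigenvalue_root_char_poly[OF C] by (auto simp: eigenvalue_def)
  then have v: "v \<in> carrier_vec n" "v \<noteq> 0\<^sub>v n" and Cv: "C *\<^sub>v v = \<mu> \<cdot>\<^sub>v v"
    using C by (auto simp: eigenvector_def)
  have Cv': "(\<Sum>j<n. C $$ (i,j) * v $ j) = \<mu> * v $ i" if "i < n" for i
    using arg_cong[OF Cv, of "\<lambda>x. x $ i"] that C v(1)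
    by (simp add: scalar_prod_def atLeast0LessThan)
  have symC: "C $$ (i,j) = C $$ (j,i)" and cnjC: "cnj (C $$ (i,j)) = C $$ (i,j)"
    if "i < n" "j < n" for i j
    using that A arg_cong[OF sym, of "\<lambda>x. x $$ (i,j)"] by (auto simp: C_def)
  define s where "s = (\<Sum>i<n. v $ i * cnj (v $ i))"
  have "\<mu> * s = (\<Sum>i<n. (\<Sum>j<n. C $$ (i,j) * v $ j) * cnj (v $ i))"
    by (simp add: s_def sum_distrib_left Cv' mult.assoc)
  also have "\<dots> = (\<Sum>i<n. \<Sum>j<n. C $$ (i,j) * v $ j * cnj (v $ i))"
    by (simp add: sum_distrib_right)
  also have "\<dots> = (\<Sum>j<n. \<Sum>i<n. C $$ (i,j) * v $ j * cnj (v $ i))"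
    by (rule sum.swap)
  also have "\<dots> = (\<Sum>j<n. \<Sum>i<n. cnj (C $$ (j,i) * v $ i) * v $ j)"
    by (intro sum.cong refl) (simp add: cnjC symC mult_ac)
  also have "\<dots> = (\<Sum>j<n. cnj (\<mu> * v $ j) * v $ j)"
    by (intro sum.cong refl) (simp only: sum_distrib_right[symmetric] cnj_sum[symmetric] Cv' lessThan_iff)
  also have "\<dots> = cnj \<mu> * s"
    by (simp add: s_def sum_distrib_left mult_ac)
  finally have eq: "\<mu> * s = cnj \<mu> * s" .
  obtain k where k: "k < n" "v $ k \<noteq> 0" using v by (metis eq_vecI carrier_vecD index_zero_vec)
  have "s = of_real (\<Sum>i<n. (cmod (v $ i))\<^sup>2)"
    by (simp only: s_def complex_norm_square of_real_sum)
  moreover have "(\<Sum>i<n. (cmod (v $ i))\<^sup>2) \<noteq> 0"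
    using k by (auto simp: sum_nonneg_eq_0_iff)
  ultimately have "s \<noteq> 0" by (simp del: of_real_sum)
  with eq have "\<mu> = cnj \<mu>" by simp
  then obtain l where l: "\<mu> = complex_of_real l"
    using Reals_cnj_iff by (metis Reals_cases)
  have "poly (char_poly A) l = 0"
    using root by (simp add: C_def l of_real_hom.char_poly_hom[OF A])
  then show ?thesis using eigenvalue_root_char_poly[OF A] by auto
qed

text \<open>The Householder reflection exchanging the first unit vector e_0 and \<open>v\<close>:
  with w = v - e_0 take I - 2 w w' / |w|^2. It supplies an orthogonal matrix with prescribed first
  column that is its own inverse.\<close>

lemma reflection_exists:
  fixes v :: "nat \<Rightarrow> real"
  assumes n: "0 < n" and v: "(\<Sum>i<n. (v i)\<^sup>2) = 1"
  obtains H where "H \<in> carrier_mat n n" "transpose_mat H = H" "H * H = 1\<^sub>m n"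
    "\<And>i. i < n \<Longrightarrow> H $$ (i,0) = v i"
proof -
  define w where "w i = v i - (if i = 0 then 1 else 0)" for i
  define q where "q = (\<Sum>i<n. w i * w i)"
  define c where "c = 2 / q"
  define H where "H = mat n n (\<lambda>(i,j). (if i = j then 1 else 0) - c * w i * w j)"
  have q: "q = 2 - 2 * v 0"
  proof -
    have "q = (\<Sum>i<n. (v i)\<^sup>2 + (if i = 0 then 1 - 2 * v 0 else 0))"
      unfolding q_def w_def by (intro sum.cong refl) (auto simp: power2_eq_square algebra_simps)
    also have "\<dots> = 2 - 2 * v 0"
      using n v by (simp add: sum.distrib)
    finally show ?thesis .
  qed
  \<comment> \<open>Division by zero yields 0, so for \<open>v\<close> = e_0 the constant
    \<open>c\<close> vanishes, \<open>H\<close> is the identity and the equation still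
    holds.\<close>
  have cc: "c * c * q = 2 * c" by (simp add: c_def)
  show thesis
  proof
    show H: "H \<in> carrier_mat n n" by (simp add: H_def)
    show "transpose_mat H = H" by (rule eq_matI) (auto simp: H_def mult_ac)
    show "H * H = 1\<^sub>m n"
    proof (rule eq_matI)
      fix i j assume "i < dim_row (1\<^sub>m n :: real mat)" "j < dim_col (1\<^sub>m n :: real mat)"
      then have ij: "i < n" "j < n" by auto
      have "(H * H) $$ (i,j) = (\<Sum>l<n. ((if i = l then 1 else 0) - c * w i * w l) * ((if l = j then 1 else 0) - c * w l * w j))"
        using ij by (subst mult_mat_index[OF H H]) (auto simp: H_def)
      also have "\<dots> = (\<Sum>l<n. (if i = l then (if i = j then 1 else 0) - c * w i * w j else 0) - (if l = j then c * w i * w j else 0) + c * c * w i * w j * (w l * w l))"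
        by (intro sum.cong refl) (auto simp: algebra_simps)
      also have "\<dots> = (if i = j then 1 else 0) - 2 * c * w i * w j + c * c * w i * w j * q"
        using ij by (simp add: sum.distrib sum_subtractf q_def sum_distrib_left)
      also have "c * c * w i * w j * q = (c * c * q) * w i * w j" by simp
      finally show "(H * H) $$ (i,j) = 1\<^sub>m n $$ (i,j)" using ij cc by simp
    qed (auto simp: H_def)
    show "H $$ (i,0) = v i" if i: "i < n" for i
    proof (cases "q = 0")
      case True
      then have "\<forall>i\<in>{..<n}. w i * w i = 0"
        unfolding q_def by (subst (asm) sum_nonneg_eq_0_iff) auto
      then have "w i = 0" using i by auto
      then show ?thesis using i n True by (auto simp: H_def w_def c_def split: if_splits)
    next
      case False
      then have "c * w 0 = -1" using q by (simp add: c_def w_def field_simps)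
      then have "c * w i * w 0 = - w i" by (metis mult.assoc mult.commute mult_minus1)
      then show ?thesis using i n by (auto simp: H_def w_def)
    qed
  qed
qed

text \<open>Deflation: reflecting a unit eigenvector to the first coordinate clears the first row
  and column off the diagonal, and the trailing block is again symmetric. The pair \<open>Q\<close>,
  \<open>transpose_mat Q\<close> inside \<open>similar_mat_wit\<close> encodes the orthogonality of
  \<open>Q\<close>.\<close>

lemma real_symmetric_diagonalization:
  fixes A :: "real mat"
  assumes "A \<in> carrier_mat n n" "transpose_mat A = A"
  shows "\<exists>Q d. similar_mat_wit A (mat n n (\<lambda>(i,j). if i = j then d i else 0)) Q (transpose_mat Q)"
  using assms
proof (induction n arbitrary: A)
  case 0
  then have "A = mat 0 0 (\<lambda>(i,j). if i = j then (\<lambda>_. 0) i else 0)" by (intro eq_matI) auto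
  then have "similar_mat_wit A (mat 0 0 (\<lambda>(i,j). if i = j then (\<lambda>_. 0) i else 0)) (1\<^sub>m 0) (transpose_mat (1\<^sub>m 0))"
    using similar_mat_wit_refl[OF 0(1)] by simp
  then show ?case by (intro exI)
next
  case (Suc m)
  let ?n = "Suc m"
  note A = Suc.prems(1)
  obtain l where "eigenvalue A l"
    using real_symmetric_eigenvalue_exists[OF Suc.prems] by auto
  then obtain v where v: "v \<in> carrier_vec ?n" "v \<noteq> 0\<^sub>v ?n" and Av: "A *\<^sub>v v = l \<cdot>\<^sub>v v"
    using A by (auto simp: eigenvalue_def eigenvector_def)
  obtain k where k: "k < ?n" "v $ k \<noteq> 0" using v by (metis eq_vecI carrier_vecD index_zero_vec)
  define s where "s = (\<Sum>i<?n. (v $ i)\<^sup>2)"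
  have s: "s > 0" unfolding s_def using k by (intro sum_pos2[of _ k]) auto
  define w where "w i = v $ i / sqrt s" for i
  have w1: "(\<Sum>i<?n. (w i)\<^sup>2) = 1"
    using s by (simp only: w_def power_divide sum_divide_distrib[symmetric] s_def[symmetric]) simp
  have Aw: "(\<Sum>j<?n. A $$ (i,j) * w j) = l * w i" if "i < ?n" for i
  proof -
    have "(\<Sum>j<?n. A $$ (i,j) * v $ j) = l * v $ i"
      using arg_cong[OF Av, of "\<lambda>x. x $ i"] that A v(1)
      by (simp add: scalar_prod_def atLeast0LessThan)
    then show ?thesis
      by (simp only: w_def times_divide_eq_right sum_divide_distrib[symmetric])
  qed
  obtain H where H: "H \<in> carrier_mat ?n ?n" "transpose_mat H = H" "H * H = 1\<^sub>m ?n"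
    and Hw: "\<And>i. i < ?n \<Longrightarrow> H $$ (i,0) = w i"
    using reflection_exists[OF _ w1] by blast
  define B where "B = H * (A * H)"
  have B: "B \<in> carrier_mat ?n ?n" using A H by (auto simp: B_def)
  have "transpose_mat B = B"
    using A H Suc.prems(2) by (simp add: B_def transpose_mult[of _ ?n ?n _ ?n] assoc_mult_mat[of _ ?n ?n _ ?n _ ?n])
  then have symB: "B $$ (i,j) = B $$ (j,i)" if "i < ?n" "j < ?n" for i j
    using that B by (metis carrier_matD index_transpose_mat(1))
  \<comment> \<open>The first column of \<open>H\<close> is the eigenvector w and
    \<open>H * H\<close> is the identity, so B e_0 = H A w = l H w = l e_0.\<close>
  have B0: "B $$ (i,0) = (if i = 0 then l else 0)" if i: "i < ?n" for i
  proof -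
    have "B $$ (i,0) = (\<Sum>k<?n. H $$ (i,k) * (A * H) $$ (k,0))"
      unfolding B_def using A H i by (subst mult_mat_index[of _ ?n ?n _ ?n]) auto
    also have "\<dots> = (\<Sum>k<?n. H $$ (i,k) * (l * H $$ (k,0)))"
      using A H by (intro sum.cong refl arg_cong2[of _ _ _ _ "(*)"], subst mult_mat_index[of _ ?n ?n _ ?n])
        (auto simp: Hw Aw simp del: sum.lessThan_Suc)
    also have "\<dots> = l * (H * H) $$ (i,0)"
      using H(1) i by (subst mult_mat_index[of _ ?n ?n _ ?n]) (auto simp: sum_distrib_left mult_ac simp del: sum.lessThan_Suc)
    finally show ?thesis using H(3) i by simp
  qed
  define A' where "A' = mat m m (\<lambda>(i,j). B $$ (Suc i, Suc j))"
  have A': "A' \<in> carrier_mat m m" by (simp add: A'_def)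
  have "transpose_mat A' = A'" by (rule eq_matI) (auto simp: A'_def symB)
  from Suc.IH[OF A' this] obtain Q d where
    Qd: "similar_mat_wit A' (mat m m (\<lambda>(i,j). if i = j then d i else 0)) Q (transpose_mat Q)" by blast
  note Q = similar_mat_witD2(6)[OF A' Qd]
  define E where "E = mat 1 1 (\<lambda>(i::nat,j::nat). l)"
  define d' where "d' i = (case i of 0 \<Rightarrow> l | Suc i \<Rightarrow> d i)" for i
  let ?D = "mat m m (\<lambda>(i,j). if i = j then d i else 0)"
  let ?P = "four_block_mat (1\<^sub>m 1) (0\<^sub>m 1 m) (0\<^sub>m m 1) Q"
  let ?P' = "four_block_mat (1\<^sub>m 1) (0\<^sub>m 1 m) (0\<^sub>m m 1) (transpose_mat Q)"
  have E: "E \<in> carrier_mat 1 1" by (simp add: E_def)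
  have BE: "B = four_block_mat E (0\<^sub>m 1 m) (0\<^sub>m m 1) A'"
  proof (rule eq_matI)
    fix i j assume "i < dim_row (four_block_mat E (0\<^sub>m 1 m) (0\<^sub>m m 1) A')"
      "j < dim_col (four_block_mat E (0\<^sub>m 1 m) (0\<^sub>m m 1) A')"
    then have ij: "i < ?n" "j < ?n" using E A' by auto
    then show "B $$ (i,j) = four_block_mat E (0\<^sub>m 1 m) (0\<^sub>m m 1) A' $$ (i,j)"
      using E A' B0[of i] B0[of j] symB[of 0 j] by (cases i; cases j) (auto simp: E_def A'_def)
  qed (use B E A' in auto)
  have DE: "mat ?n ?n (\<lambda>(i,j). if i = j then d' i else 0) = four_block_mat E (0\<^sub>m 1 m) (0\<^sub>m m 1) ?D"
  proof (rule eq_matI)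
    fix i j assume "i < dim_row (four_block_mat E (0\<^sub>m 1 m) (0\<^sub>m m 1) ?D)"
      "j < dim_col (four_block_mat E (0\<^sub>m 1 m) (0\<^sub>m m 1) ?D)"
    then have ij: "i < ?n" "j < ?n" using E by auto
    then show "mat ?n ?n (\<lambda>(i,j). if i = j then d' i else 0) $$ (i,j) = four_block_mat E (0\<^sub>m 1 m) (0\<^sub>m m 1) ?D $$ (i,j)"
      using E by (cases i; cases j) (auto simp: E_def d'_def)
  qed (use E in auto)
  have "similar_mat_wit (four_block_mat E (0\<^sub>m 1 m) (0\<^sub>m m 1) A')
      (four_block_mat E (0\<^sub>m 1 m) (0\<^sub>m m 1) ?D) ?P ?P'"
    using similar_mat_wit_refl[OF E] Qd E A'
    by (intro similar_mat_wit_four_block[where n = 1 and m = m]) (use Q in auto)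
  note BD = this[folded BE DE]
  have AB: "similar_mat_wit A B H H"
  proof (rule similar_mat_witI[of _ _ ?n])
    have "H * B * H = (H * H) * A * (H * H)"
      unfolding B_def using A H(1) by (simp add: assoc_mult_mat[of _ ?n ?n _ ?n _ ?n])
    then show "A = H * B * H" using A H(3) by simp
  qed (use A B H in auto)
  have P: "?P \<in> carrier_mat ?n ?n" using Q by auto
  have "?P' = transpose_mat ?P"
    by (simp add: transpose_four_block_mat[OF one_carrier_mat zero_carrier_mat zero_carrier_mat Q])
  then have "?P' * H = transpose_mat (H * ?P)"
    using H(2) transpose_mult[OF H(1) P] by simp
  with similar_mat_wit_trans[OF AB BD]
  have "similar_mat_wit A (mat ?n ?n (\<lambda>(i,j). if i = j then d' i else 0)) (H * ?P) (transpose_mat (H * ?P))"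
    by simp
  then show ?case by (intro exI)
qed

section \<open>Singular values and low-rank approximation\<close>

lemma sum_rotate:
  "(\<Sum>x\<in>A. \<Sum>y\<in>B. \<Sum>z\<in>C. h x y z) = (\<Sum>y\<in>B. \<Sum>z\<in>C. \<Sum>x\<in>A. h x y z)"
  by (subst sum.swap, rule sum.cong[OF refl], rule sum.swap)

text \<open>The squared norms \<open>c s\<close> are left arbitrary so that one expansion serves
  orthonormal families, families padded with zero vectors, and the unnormalized right factors of an
  SVD. Taking x = 0 turns it into Parseval's identity.\<close>

lemma orthogonal_family_expansion:
  fixes x :: "'b \<Rightarrow> real"
  assumes fin: "finite I"
    and orth: "\<And>s r. s \<in> I \<Longrightarrow> r \<in> I \<Longrightarrow> (\<Sum>j\<in>J. p s j * p r j) = (if s = r then c s else 0)"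
  shows "(\<Sum>j\<in>J. (x j - (\<Sum>s\<in>I. g s * p s j))\<^sup>2)
    = (\<Sum>j\<in>J. (x j)\<^sup>2) - 2 * (\<Sum>s\<in>I. g s * (\<Sum>j\<in>J. x j * p s j)) + (\<Sum>s\<in>I. (g s)\<^sup>2 * c s)"
proof -
  have 1: "(\<Sum>j\<in>J. x j * (\<Sum>s\<in>I. g s * p s j)) = (\<Sum>s\<in>I. g s * (\<Sum>j\<in>J. x j * p s j))"
    unfolding sum_distrib_left by (subst sum.swap) (simp add: mult_ac)
  have "(\<Sum>j\<in>J. (\<Sum>s\<in>I. g s * p s j)\<^sup>2)
      = (\<Sum>j\<in>J. \<Sum>s\<in>I. \<Sum>r\<in>I. g s * g r * (p s j * p r j))"
    unfolding power2_eq_square sum_product by (intro sum.cong refl) (simp add: mult_ac)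
  also have "\<dots> = (\<Sum>s\<in>I. \<Sum>r\<in>I. \<Sum>j\<in>J. g s * g r * (p s j * p r j))"
    by (rule sum_rotate)
  also have "\<dots> = (\<Sum>s\<in>I. \<Sum>r\<in>I. g s * g r * (if s = r then c s else 0))"
    by (intro sum.cong refl) (simp only: sum_distrib_left[symmetric] orth)
  also have "\<dots> = (\<Sum>s\<in>I. (g s)\<^sup>2 * c s)"
    by (intro sum.cong refl) (simp add: fin if_distrib[of "(*) _"] power2_eq_square cong: if_cong)
  finally have 2: "(\<Sum>j\<in>J. (\<Sum>s\<in>I. g s * p s j)\<^sup>2) = (\<Sum>s\<in>I. (g s)\<^sup>2 * c s)" .
  have "(\<Sum>j\<in>J. (x j - (\<Sum>s\<in>I. g s * p s j))\<^sup>2)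
      = (\<Sum>j\<in>J. (x j)\<^sup>2 - 2 * (x j * (\<Sum>s\<in>I. g s * p s j)) + (\<Sum>s\<in>I. g s * p s j)\<^sup>2)"
    by (intro sum.cong refl) (simp add: power2_diff)
  then show ?thesis
    by (simp only: sum.distrib sum_subtractf 1 2 sum_distrib_left[symmetric])
qed

text \<open>The squared distance from x to the combination with coefficients <x, p_s> is
  nonnegative; as c s \<le> 1, it is at most |x|^2 minus the sum of the squared
  coefficients.\<close>

lemma Bessel_inequality:
  fixes x :: "'b \<Rightarrow> real"
  assumes fin: "finite I"
    and orth: "\<And>s r. s \<in> I \<Longrightarrow> r \<in> I \<Longrightarrow> (\<Sum>j\<in>J. p s j * p r j) = (if s = r then c s else 0)"
    and c: "\<And>s. s \<in> I \<Longrightarrow> c s \<le> 1"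
  shows "(\<Sum>s\<in>I. (\<Sum>j\<in>J. x j * p s j)\<^sup>2) \<le> (\<Sum>j\<in>J. (x j)\<^sup>2)"
proof -
  define y where "y s = (\<Sum>j\<in>J. x j * p s j)" for s
  have "0 \<le> (\<Sum>j\<in>J. (x j - (\<Sum>s\<in>I. y s * p s j))\<^sup>2)" by (intro sum_nonneg) auto
  also have "\<dots> = (\<Sum>j\<in>J. (x j)\<^sup>2) - 2 * (\<Sum>s\<in>I. (y s)\<^sup>2) + (\<Sum>s\<in>I. (y s)\<^sup>2 * c s)"
    by (subst orthogonal_family_expansion[OF fin orth]) (auto simp: y_def power2_eq_square)
  also have "(\<Sum>s\<in>I. (y s)\<^sup>2 * c s) \<le> (\<Sum>s\<in>I. (y s)\<^sup>2)"
    using c by (intro sum_mono) (auto intro: mult_left_le)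
  finally show ?thesis by (simp add: y_def)
qed

text \<open>The total squared mass of the normalized vectors is counted in two ways: each vector
  contributes 1, while each of the \<open>T\<close> coordinates carries at most 1. It serves to show
  that the singular values beyond index \<open>T\<close> vanish.\<close>

lemma card_le_of_orthogonal:
  fixes a :: "nat \<Rightarrow> nat \<Rightarrow> real"
  assumes fin: "finite I"
    and orth: "\<And>s r. s \<in> I \<Longrightarrow> r \<in> I \<Longrightarrow> (\<Sum>t<T. a s t * a r t) = (if s = r then d s else 0)"
    and pos: "\<And>s. s \<in> I \<Longrightarrow> d s > 0"
  shows "card I \<le> T"
proof -
  define p where "p s t = a s t / sqrt (d s)" for s t
  have p: "(\<Sum>t<T. p s t * p r t) = (if s = r then 1 else 0)" if "s \<in> I" "r \<in> I" for s r
  proof -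
    have "(\<Sum>t<T. p s t * p r t) = (\<Sum>t<T. a s t * a r t) / (sqrt (d s) * sqrt (d r))"
      by (simp add: p_def sum_divide_distrib)
    also have "\<dots> = (if s = r then 1 else 0)"
      using orth[OF that] pos[OF that(1)] by (auto simp: less_imp_le)
    finally show ?thesis .
  qed
  have "real (card I) = (\<Sum>s\<in>I. \<Sum>t<T. (p s t)\<^sup>2)"
    by (simp add: power2_eq_square p)
  also have "\<dots> = (\<Sum>t<T. \<Sum>s\<in>I. (p s t)\<^sup>2)" by (rule sum.swap)
  also have "\<dots> \<le> (\<Sum>t<T. 1)"
  proof (rule sum_mono)
    fix t assume t: "t \<in> {..<T}"
    \<comment> \<open>Bessel's inequality at the unit vector of coordinate \<open>t\<close>.\<close>
    have "(\<Sum>s\<in>I. (\<Sum>j<T. of_bool (j = t) * p s j)\<^sup>2) \<le> (\<Sum>j<T. (of_bool (j = t))\<^sup>2)"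
      using p by (intro Bessel_inequality[OF fin, where c = "\<lambda>_. 1"]) auto
    moreover have "(\<Sum>j<T. of_bool (j = t) * p s j) = p s t" for s
      using t by simp
    moreover have "(\<Sum>j<T. (of_bool (j = t))\<^sup>2) = (\<Sum>j<T. if j = t then 1 else (0::real))"
      by (intro sum.cong) auto
    ultimately show "(\<Sum>s\<in>I. (p s t)\<^sup>2) \<le> 1" using t by simp
  qed
  finally show ?thesis by simp
qed

text \<open>The rows \<open>u i\<close> are the left singular vectors and \<open>a i\<close> is A'
  u_i, the right singular vector already multiplied by its singular value; leaving it unnormalized
  avoids dividing by zero singular values. \<open>d\<close> lists the squared singular values from
  index 0, against the one-based \<open>sing_val\<close>.\<close>

lemma singular_value_decomposition:
  fixes A :: "nat \<Rightarrow> nat \<Rightarrow> real"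
  obtains u a :: "nat \<Rightarrow> nat \<Rightarrow> real" and d :: "nat \<Rightarrow> real" where
    "\<And>i k. i < N \<Longrightarrow> k < N \<Longrightarrow> (\<Sum>j<N. u i j * u k j) = (if i = k then 1 else 0)"
    "\<And>j l. j < N \<Longrightarrow> l < N \<Longrightarrow> (\<Sum>i<N. u i j * u i l) = (if j = l then 1 else 0)"
    "\<And>i k. i < N \<Longrightarrow> k < N \<Longrightarrow> (\<Sum>t<T. a i t * a k t) = (if i = k then d i else 0)"
    "\<And>j t. j < N \<Longrightarrow> A j t = (\<Sum>i<N. a i t * u i j)"
    "\<And>i. i < N \<Longrightarrow> d i \<ge> 0"
    "\<And>i k. i \<le> k \<Longrightarrow> k < N \<Longrightarrow> d k \<le> d i"
    "\<And>i. T \<le> i \<Longrightarrow> i < N \<Longrightarrow> d i = 0"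
    "\<And>i. i < N \<Longrightarrow> (sing_val (Suc i) (to_mat N T A))\<^sup>2 = d i"
    "\<And>i. i < N \<Longrightarrow> sing_val (Suc i) (to_mat N T A) \<ge> 0"
proof -
  define B where "B = to_mat N T A * transpose_mat (to_mat N T A)"
  have carr: "to_mat N T A \<in> carrier_mat N T" by (simp add: to_mat_def)
  have B: "B \<in> carrier_mat N N" using carr by (simp add: B_def)
  have Bij: "B $$ (j,l) = (\<Sum>t<T. A j t * A l t)" if "j < N" "l < N" for j l
    unfolding B_def using carr that
    by (subst mult_mat_index[of _ N T _ N]) (auto simp: to_mat_def)
  have "transpose_mat B = B"
    by (rule eq_matI) (use B in \<open>auto simp: Bij mult_ac\<close>)
  then obtain Q e where Qe: "similar_mat_wit B (mat N N (\<lambda>(i,j). if i = j then e i else 0)) Q (transpose_mat Q)"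
    using real_symmetric_diagonalization[OF B] by auto
  define D where "D = mat N N (\<lambda>(i,j). if i = j then e i else (0::real))"
  note Qe = Qe[folded D_def]
  note QD = similar_mat_witD2[OF B Qe]
  note Q = QD(6)
  have QtQ: "(\<Sum>j<N. Q $$ (j,i) * Q $$ (j,k)) = (if i = k then 1 else 0)" if "i < N" "k < N" for i k
    using arg_cong[OF QD(2), of "\<lambda>M. M $$ (i,k)"] that Q
    by (simp add: mult_mat_index[of _ N N _ N] del: index_mult_mat)
  have QQt: "(\<Sum>j<N. Q $$ (i,j) * Q $$ (k,j)) = (if i = k then 1 else 0)" if "i < N" "k < N" for i k
    using arg_cong[OF QD(1), of "\<lambda>M. M $$ (i,k)"] that Q
    by (simp add: mult_mat_index[of _ N N _ N] del: index_mult_mat)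
  have "B * Q = Q * D * (transpose_mat Q * Q)"
    using QD(3) QD(5) Q by (simp add: assoc_mult_mat[of _ N N _ N _ N])
  then have BQ: "B * Q = Q * D" using QD Q by simp
  have BQ': "(\<Sum>l<N. B $$ (j,l) * Q $$ (l,k)) = Q $$ (j,k) * e k" if "j < N" "k < N" for j k
  proof -
    have "(\<Sum>l<N. B $$ (j,l) * Q $$ (l,k)) = (Q * D) $$ (j,k)"
      using B Q that by (simp add: BQ[symmetric] mult_mat_index[of _ N N _ N] del: index_mult_mat)
    also have "\<dots> = (\<Sum>l<N. if l = k then Q $$ (j,k) * e k else 0)"
      using that by (subst mult_mat_index[OF Q QD(5)]) (auto simp: D_def if_distrib[of "(*) _"] cong: if_cong)
    finally show ?thesis using that by simp
  qed
  have "upper_triangular D" by (auto simp: D_def)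
  moreover have "diag_mat D = map e [0..<N]" by (auto simp: diag_mat_def D_def)
  moreover have "char_poly B = char_poly D"
    using Qe by (intro char_poly_similar) (auto simp: similar_mat_def)
  ultimately have cp: "char_poly B = (\<Prod>x\<leftarrow>map e [0..<N]. [:- x, 1:])"
    using char_poly_upper_triangular[OF QD(5)] by simp
  have "proots (\<Prod>x\<leftarrow>xs. [:- x, 1:]) = mset xs" for xs :: "real list"
  proof (induction xs)
    case (Cons x xs)
    have "(\<Prod>x\<leftarrow>xs. [:- x, 1:]) \<noteq> (0 :: real poly)"
      by (auto simp: prod_list_zero_iff)
    then have "proots ([:- x, 1:] * (\<Prod>x\<leftarrow>xs. [:- x, 1:])) = {#x#} + mset xs"
      by (subst proots_mult) (simp_all add: Cons.IH)
    then show ?case by simp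
  qed simp
  then have pr: "proots (char_poly B) = mset (map e [0..<N])"
    unfolding cp by blast
  define ds where "ds = sq_singular_values (to_mat N T A)"
  have ds: "ds = rev (sorted_list_of_multiset (mset (map e [0..<N])))"
    unfolding ds_def sq_singular_values_def B_def[symmetric] pr ..
  have mds: "mset ds = mset (map e [0..<N])" unfolding ds by simp
  have len: "length ds = N" using arg_cong[OF mds, of size] by simp
  \<comment> \<open>The eigenvectors must follow the eigenvalues into decreasing order:
    \<open>p\<close> is a sorting permutation, and \<open>u\<close> will read the columns of
    \<open>Q\<close> through it.\<close>
  obtain p where p: "p permutes {..<N}" and "permute_list p (map e [0..<N]) = ds"
    using mset_eq_permutation[OF mds] by auto
  then have dsi: "ds ! i = e (p i)" if "i < N" for i
    using that permutes_in_image[OF p, of i] by (auto simp: permute_list_nth)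
  have pN: "p i < N" if "i < N" for i using permutes_in_image[OF p, of i] that by auto
  have pinj: "p i = p k \<longleftrightarrow> i = k" for i k using permutes_inj[OF p] by (auto dest: injD)
  define u where "u i j = Q $$ (j, p i)" for i j
  define a where "a i t = (\<Sum>j<N. u i j * A j t)" for i t
  have 1: "(\<Sum>j<N. u i j * u k j) = (if i = k then 1 else 0)" if "i < N" "k < N" for i k
    using that by (simp add: u_def QtQ pN pinj)
  have 2: "(\<Sum>i<N. u i j * u i l) = (if j = l then 1 else 0)" if "j < N" "l < N" for j l
    unfolding u_def using QQt[OF that] sum.permute[OF p, of "\<lambda>i. Q $$ (j,i) * Q $$ (l,i)"]
    by (simp add: o_def)
  have 3: "(\<Sum>t<T. a i t * a k t) = (if i = k then ds ! i else 0)" if "i < N" "k < N" for i k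
  proof -
    have "(\<Sum>t<T. a i t * a k t) = (\<Sum>t<T. \<Sum>j<N. \<Sum>l<N. u i j * u k l * (A j t * A l t))"
      unfolding a_def sum_product by (simp add: mult_ac)
    also have "\<dots> = (\<Sum>j<N. \<Sum>l<N. \<Sum>t<T. u i j * u k l * (A j t * A l t))"
      by (rule sum_rotate)
    also have "\<dots> = (\<Sum>j<N. u i j * (\<Sum>l<N. B $$ (j,l) * u k l))"
      by (simp add: Bij sum_distrib_left sum_distrib_right mult_ac)
    also have "\<dots> = (\<Sum>j<N. u i j * u k j) * e (p k)"
      using that by (simp add: u_def BQ' pN sum_distrib_right mult.assoc)
    finally show ?thesis using that by (simp add: 1 dsi)
  qed
  have 4: "A j t = (\<Sum>i<N. a i t * u i j)" if "j < N" for j t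
  proof -
    have "(\<Sum>i<N. a i t * u i j) = (\<Sum>i<N. \<Sum>l<N. A l t * (u i l * u i j))"
      unfolding a_def sum_distrib_right by (simp add: mult_ac)
    also have "\<dots> = (\<Sum>l<N. A l t * (\<Sum>i<N. u i l * u i j))"
      by (subst sum.swap) (simp add: sum_distrib_left)
    also have "\<dots> = (\<Sum>l<N. if l = j then A j t else 0)"
      using that by (intro sum.cong refl) (simp add: 2)
    finally show ?thesis using that by simp
  qed
  have 5: "ds ! i \<ge> 0" if "i < N" for i
    using 3[OF that that] sum_nonneg[of "{..<T}" "\<lambda>t. a i t * a i t"] by simp
  have 6: "ds ! k \<le> ds ! i" if "i \<le> k" "k < N" for i k
    using sorted_rev_nth_mono[of ds i k] that len by (simp add: ds)
  \<comment> \<open>A nonzero value at an index i \<ge> T would make all values at 0, ..., T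
    positive, giving \<open>T\<close> + 1 nonzero orthogonal vectors in dimension
    \<open>T\<close>.\<close>
  have 7: "ds ! i = 0" if "T \<le> i" "i < N" for i
  proof (rule ccontr)
    assume "ds ! i \<noteq> 0"
    then have "ds ! i > 0" using 5[OF that(2)] by simp
    then have "ds ! s > 0" if "s \<in> {..T}" for s
      using 6[of s i] that \<open>T \<le> i\<close> \<open>i < N\<close> by auto
    then have "card {..T} \<le> T"
      using that by (intro card_le_of_orthogonal[of _ a T "(!) ds"]) (auto simp: 3)
    then show False by simp
  qed
  have 8: "(sing_val (Suc i) (to_mat N T A))\<^sup>2 = ds ! i" "sing_val (Suc i) (to_mat N T A) \<ge> 0"
    if "i < N" for i
    using 5[OF that] by (simp_all add: sing_val_def ds_def)
  show thesis using that[OF 1 2 3 4 5 6 7 8] by blast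
qed

section \<open>Best rank-m approximation: both halves of Eckart-Young\<close>

lemma sum_sing_val_squares:
  assumes "\<And>i. i < N \<Longrightarrow> (sing_val (Suc i) M)\<^sup>2 = d i"
  shows "(\<Sum>r\<in>{m + 1..min N T}. (sing_val r M)\<^sup>2) = (\<Sum>i\<in>{m..<min N T}. d i)"
  by (rule sum.reindex_bij_witness[of _ Suc "\<lambda>r. r - 1"]) (auto simp: assms[symmetric])

text \<open>Truncating the SVD after \<open>R\<close> terms leaves exactly the tail of the squared
  singular values as residual.\<close>

lemma low_rank_approximation:
  fixes A :: "nat \<Rightarrow> nat \<Rightarrow> real"
  obtains lam f :: "nat \<Rightarrow> nat \<Rightarrow> real" where
    "(\<Sum>i<N. \<Sum>t<T. (A i t - (\<Sum>r<R. lam i r * f t r))\<^sup>2)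
       \<le> (\<Sum>r\<in>{R + 1..min N T}. (sing_val r (to_mat N T A))\<^sup>2)"
proof -
  obtain u a :: "nat \<Rightarrow> nat \<Rightarrow> real" and d :: "nat \<Rightarrow> real" where
    uu: "\<And>i k. i < N \<Longrightarrow> k < N \<Longrightarrow> (\<Sum>j<N. u i j * u k j) = (if i = k then 1 else 0)" and
    aa: "\<And>i k. i < N \<Longrightarrow> k < N \<Longrightarrow> (\<Sum>t<T. a i t * a k t) = (if i = k then d i else 0)" and
    A: "\<And>j t. j < N \<Longrightarrow> A j t = (\<Sum>i<N. a i t * u i j)" and
    d0: "\<And>i. T \<le> i \<Longrightarrow> i < N \<Longrightarrow> d i = 0" and
    sv: "\<And>i. i < N \<Longrightarrow> (sing_val (Suc i) (to_mat N T A))\<^sup>2 = d i"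
    by (rule singular_value_decomposition[where N = N and T = T and A = A]) blast
  \<comment> \<open>For \<open>R\<close> > \<open>N\<close> there are only \<open>N\<close> singular
    vectors; the surplus factors are set to zero.\<close>
  define lam where "lam j r = (if r < N then u r j else 0)" for j r
  define f where "f t r = a r t" for t r
  have res: "A j t - (\<Sum>r<R. lam j r * f t r) = (\<Sum>i\<in>{R..<N}. a i t * u i j)" if "j < N" for j t
  proof -
    have "(\<Sum>r<R. lam j r * f t r) = (\<Sum>i\<in>{..<N} \<inter> {..<R}. a i t * u i j)"
      by (intro sum.mono_neutral_cong_right) (auto simp: lam_def f_def)
    moreover have "A j t = (\<Sum>i\<in>{..<N} \<inter> {..<R}. a i t * u i j) + (\<Sum>i\<in>{..<N} - {..<R}. a i t * u i j)"
      unfolding A[OF that] by (rule sum.Int_Diff) simp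
    moreover have "{..<N} - {..<R} = {R..<N}" by auto
    ultimately show ?thesis by simp
  qed
  have "(\<Sum>i<N. \<Sum>t<T. (A i t - (\<Sum>r<R. lam i r * f t r))\<^sup>2)
      = (\<Sum>t<T. \<Sum>j<N. (\<Sum>i\<in>{R..<N}. a i t * u i j)\<^sup>2)"
    by (subst sum.swap) (simp add: res)
  also have "\<dots> = (\<Sum>t<T. \<Sum>i\<in>{R..<N}. (a i t)\<^sup>2)"
  proof (rule sum.cong[OF refl])
    fix t
    show "(\<Sum>j<N. (\<Sum>i\<in>{R..<N}. a i t * u i j)\<^sup>2) = (\<Sum>i\<in>{R..<N}. (a i t)\<^sup>2)"
      using orthogonal_family_expansion[of "{R..<N}" u "{..<N}" "\<lambda>_. 1" "\<lambda>_. 0" "\<lambda>i. a i t"] uu by simp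
  qed
  also have "\<dots> = (\<Sum>i\<in>{R..<N}. d i)"
    by (subst sum.swap) (simp add: power2_eq_square aa)
  also have "\<dots> = (\<Sum>i\<in>{R..<min N T}. d i)"
    using d0 by (intro sum.mono_neutral_right) auto
  also have "\<dots> = (\<Sum>r\<in>{R + 1..min N T}. (sing_val r (to_mat N T A))\<^sup>2)"
    by (rule sum_sing_val_squares[OF sv, symmetric])
  finally show thesis by (intro that eq_refl)
qed

text \<open>Vectors left over by linear dependencies are replaced by zero vectors, so the
  family keeps its length and the squared norms are 0 or 1.\<close>
lemma Gram_Schmidt_factorization:
  fixes lam f :: "nat \<Rightarrow> nat \<Rightarrow> real"
  shows "\<exists>p c g. (\<forall>s<m. \<forall>r<m. (\<Sum>j<N. p s j * p r j) = (if s = r then c s else (0::real)))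
     \<and> (\<forall>s<m. c s = 0 \<or> c s = (1::real))
     \<and> (\<forall>j<N. \<forall>t. (\<Sum>r<m. lam j r * f t r) = (\<Sum>s<m. g t s * p s j))"
proof (induction m)
  case 0
  then show ?case by simp
next
  case (Suc m)
  then obtain p c g where
    orth: "\<And>s r. s < m \<Longrightarrow> r < m \<Longrightarrow> (\<Sum>j<N. p s j * p r j) = (if s = r then c s else (0::real))" and
    c: "\<And>s. s < m \<Longrightarrow> c s = 0 \<or> c s = (1::real)" and
    g: "\<And>j t. j < N \<Longrightarrow> (\<Sum>r<m. lam j r * f t r) = (\<Sum>s<m. g t s * p s j)" by blast
  define y where "y s = (\<Sum>j<N. lam j m * p s j)" for s
  define res where "res j = lam j m - (\<Sum>s<m. y s * p s j)" for j
  define q where "q = (\<Sum>j<N. (res j)\<^sup>2)"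
  have q: "q \<ge> 0" unfolding q_def by (intro sum_nonneg) auto
  \<comment> \<open>A squared norm of 0 means that the vector vanishes on the index range, and then
    so does the coefficient \<open>y s\<close>.\<close>
  have y0: "y s * c s = y s" if s: "s < m" for s
  proof (cases "c s = 0")
    case True
    then have "(\<Sum>j<N. p s j * p s j) = 0" using orth[OF s s] by simp
    then have "\<forall>j\<in>{..<N}. p s j * p s j = 0" by (subst (asm) sum_nonneg_eq_0_iff) auto
    then have "y s = 0" by (simp add: y_def)
    then show ?thesis by simp
  qed (use c[OF s] in auto)
  have res_orth: "(\<Sum>j<N. res j * p s j) = 0" if s: "s < m" for s
  proof -
    have "(\<Sum>j<N. res j * p s j) = y s - (\<Sum>r<m. y r * (\<Sum>j<N. p r j * p s j))"
      by (simp add: res_def y_def left_diff_distrib sum_subtractf sum_distrib_left sum_distrib_right mult.assoc)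
        (rule sum.swap)
    also have "(\<Sum>r<m. y r * (\<Sum>j<N. p r j * p s j)) = (\<Sum>r<m. if r = s then y s * c s else 0)"
      using s by (intro sum.cong refl) (simp add: orth)
    finally show ?thesis using s y0[OF s] by simp
  qed
  \<comment> \<open>When the residual is zero, so is \<open>sqrt q\<close>, and both sides
    vanish.\<close>
  have res0: "res j / sqrt q * sqrt q = res j" if "j < N" for j
  proof (cases "q = 0")
    case True
    then have "\<forall>j\<in>{..<N}. (res j)\<^sup>2 = 0" unfolding q_def by (subst (asm) sum_nonneg_eq_0_iff) auto
    then show ?thesis using that by simp
  qed auto
  define p' where "p' = p(m := (\<lambda>j. res j / sqrt q))"
  define c' where "c' = c(m := (if q = 0 then 0 else 1))"
  \<comment> \<open>The new column is its projection, with coefficients \<open>y\<close>, plus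
    \<open>sqrt q\<close> times the new vector, so its multiplier \<open>f t m\<close> is
    distributed over both.\<close>
  define g' where "g' t s = (if s = m then f t m * sqrt q else g t s + f t m * y s)" for t s
  have pm: "(\<Sum>j<N. res j / sqrt q * p s j) = 0" if "s < m" for s
    using res_orth[OF that] by (simp add: sum_divide_distrib[symmetric])
  have "(\<Sum>j<N. p' s j * p' r j) = (if s = r then c' s else 0)" if "s < Suc m" "r < Suc m" for s r
  proof -
    have "(\<Sum>j<N. res j / sqrt q * (res j / sqrt q)) = q / (sqrt q * sqrt q)"
      by (simp add: q_def power2_eq_square sum_divide_distrib)
    then have "(\<Sum>j<N. res j / sqrt q * (res j / sqrt q)) = (if q = 0 then 0 else 1)"
      using q by simp
    then show ?thesis
      using that orth[of s r] pm[of s] pm[of r]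
      by (cases "s = m"; cases "r = m") (simp_all add: p'_def c'_def less_Suc_eq mult.commute)
  qed
  moreover have "c' s = 0 \<or> c' s = 1" if "s < Suc m" for s
    using that c[of s] by (auto simp: c'_def less_Suc_eq)
  moreover have "(\<Sum>r<Suc m. lam j r * f t r) = (\<Sum>s<Suc m. g' t s * p' s j)" if "j < N" for j t
  proof -
    have "(\<Sum>s<Suc m. g' t s * p' s j) = (\<Sum>s<m. g t s * p s j + f t m * (y s * p s j)) + f t m * (res j / sqrt q * sqrt q)"
      by (auto simp: g'_def p'_def algebra_simps intro!: sum.cong)
    also have "\<dots> = (\<Sum>r<m. lam j r * f t r) + f t m * ((\<Sum>s<m. y s * p s j) + res j)"
      by (simp only: res0[OF that] g[OF that] sum.distrib sum_distrib_left[symmetric]) (simp add: algebra_simps)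
    finally show ?thesis by (simp add: res_def)
  qed
  ultimately show ?case by blast
qed

text \<open>With weights capped at 1 and total weight at most \<open>m\<close>, the sum is largest
  when the weight sits on the \<open>m\<close> largest values. Subtracting the threshold
  \<open>d m\<close> makes the comparison termwise. This is the extremal step of Ky Fan's maximum
  principle.\<close>

lemma weighted_sum_le_initial_sum:
  fixes d w :: "nat \<Rightarrow> real"
  assumes d: "\<And>i. i < N \<Longrightarrow> d i \<ge> 0" "\<And>i k. i \<le> k \<Longrightarrow> k < N \<Longrightarrow> d k \<le> d i"
    and w: "\<And>i. i < N \<Longrightarrow> 0 \<le> w i" "\<And>i. i < N \<Longrightarrow> w i \<le> 1" "(\<Sum>i<N. w i) \<le> real m"
  shows "(\<Sum>i<N. d i * w i) \<le> (\<Sum>i<min m N. d i)"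
proof (cases "m < N")
  case False
  then have "min m N = N" by simp
  then show ?thesis using d w by (auto intro!: sum_mono mult_left_le)
next
  case True
  have "(\<Sum>i<N. d i * w i) = (\<Sum>i<N. (d i - d m) * w i) + d m * (\<Sum>i<N. w i)"
    by (simp add: sum_distrib_left sum.distrib[symmetric] algebra_simps)
  also have "\<dots> \<le> (\<Sum>i<N. if i < m then d i - d m else 0) + d m * real m"
  proof (intro add_mono sum_mono mult_left_mono w d True)
    fix i assume "i \<in> {..<N}"
    then show "(d i - d m) * w i \<le> (if i < m then d i - d m else 0)"
      using d(2)[of m i] d(2)[of i m] w(1,2)[of i] True
      by (auto intro!: mult_left_le mult_nonpos_nonneg)
  qed
  also have "(\<Sum>i<N. if i < m then d i - d m else 0) = (\<Sum>i<m. d i - d m)"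
    using True by (intro sum.mono_neutral_cong_right) auto
  finally show ?thesis using True by (simp add: sum_subtractf)
qed

text \<open>A'x is the combination of the orthogonal vectors \<open>a i\<close> with coefficients
  <u_i, x>.\<close>

lemma sum_squares_image:
  fixes A a u :: "nat \<Rightarrow> nat \<Rightarrow> real"
  assumes aa: "\<And>i k. i < N \<Longrightarrow> k < N \<Longrightarrow> (\<Sum>t<T. a i t * a k t) = (if i = k then d i else 0)"
    and A: "\<And>j t. j < N \<Longrightarrow> A j t = (\<Sum>i<N. a i t * u i j)"
  shows "(\<Sum>t<T. (\<Sum>j<N. A j t * x j)\<^sup>2) = (\<Sum>i<N. d i * (\<Sum>j<N. u i j * x j)\<^sup>2)"
proof -
  define z where "z i = (\<Sum>j<N. u i j * x j)" for i
  have "(\<Sum>j<N. A j t * x j) = (\<Sum>i<N. z i * a i t)" for t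
  proof -
    have "(\<Sum>j<N. A j t * x j) = (\<Sum>j<N. \<Sum>i<N. a i t * u i j * x j)"
      by (simp add: A sum_distrib_right)
    also have "\<dots> = (\<Sum>i<N. \<Sum>j<N. a i t * u i j * x j)" by (rule sum.swap)
    finally show ?thesis by (simp add: z_def sum_distrib_left mult_ac)
  qed
  then show ?thesis
    using orthogonal_family_expansion[of "{..<N}" a "{..<T}" d "\<lambda>_. 0" z] aa
    by (simp add: z_def mult.commute)
qed

lemma sum_squares_orthogonal_image:
  fixes u :: "nat \<Rightarrow> nat \<Rightarrow> real"
  assumes "\<And>j l. j < N \<Longrightarrow> l < N \<Longrightarrow> (\<Sum>i<N. u i j * u i l) = (if j = l then 1 else 0)"
  shows "(\<Sum>i<N. (\<Sum>j<N. u i j * x j)\<^sup>2) = (\<Sum>j<N. (x j)\<^sup>2)"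
  using orthogonal_family_expansion[of "{..<N}" "\<lambda>j i. u i j" "{..<N}" "\<lambda>_. 1" "\<lambda>_. 0" x] assms
  by (simp add: mult.commute)

text \<open>The columns of the perturbation lie in the span of at most \<open>m\<close> orthonormal
  vectors p_s, so it can remove from A at most the energy of the projection onto that span. Written
  in the singular basis, this energy is a weighted sum of the \<open>d i\<close> with weights in
  [0,1] of total at most \<open>m\<close>, hence at most the sum of the \<open>m\<close>
  largest.\<close>

lemma low_rank_approximation_lower_bound:
  fixes A lam f :: "nat \<Rightarrow> nat \<Rightarrow> real"
  shows "(\<Sum>r\<in>{m + 1..min N T}. (sing_val r (to_mat N T A))\<^sup>2)
     \<le> (\<Sum>i<N. \<Sum>t<T. (A i t + (\<Sum>r<m. lam i r * f t r))\<^sup>2)"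
proof -
  obtain u a :: "nat \<Rightarrow> nat \<Rightarrow> real" and d :: "nat \<Rightarrow> real" where
    uu: "\<And>i k. i < N \<Longrightarrow> k < N \<Longrightarrow> (\<Sum>j<N. u i j * u k j) = (if i = k then 1 else 0)" and
    uu': "\<And>j l. j < N \<Longrightarrow> l < N \<Longrightarrow> (\<Sum>i<N. u i j * u i l) = (if j = l then 1 else 0)" and
    aa: "\<And>i k. i < N \<Longrightarrow> k < N \<Longrightarrow> (\<Sum>t<T. a i t * a k t) = (if i = k then d i else 0)" and
    A: "\<And>j t. j < N \<Longrightarrow> A j t = (\<Sum>i<N. a i t * u i j)" and
    dnn: "\<And>i. i < N \<Longrightarrow> d i \<ge> 0" and
    dmono: "\<And>i k. i \<le> k \<Longrightarrow> k < N \<Longrightarrow> d k \<le> d i" and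
    sv: "\<And>i. i < N \<Longrightarrow> (sing_val (Suc i) (to_mat N T A))\<^sup>2 = d i"
    by (rule singular_value_decomposition[where N = N and T = T and A = A]) blast
  obtain p c g where
    pp: "\<And>s r. s < m \<Longrightarrow> r < m \<Longrightarrow> (\<Sum>j<N. p s j * p r j) = (if s = r then c s else (0::real))" and
    c: "\<And>s. s < m \<Longrightarrow> c s = 0 \<or> c s = (1::real)" and
    g: "\<And>j t. j < N \<Longrightarrow> (\<Sum>r<m. lam j r * f t r) = (\<Sum>s<m. g t s * p s j)"
    using Gram_Schmidt_factorization[of m N lam f] by blast
  have pp2: "(\<Sum>j<N. (p s j)\<^sup>2) = c s" if "s < m" for s
    using pp[OF that that] by (simp add: power2_eq_square)
  define y where "y s t = (\<Sum>j<N. A j t * p s j)" for s t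
  have col: "(\<Sum>j<N. (A j t)\<^sup>2) - (\<Sum>s<m. (y s t)\<^sup>2) \<le> (\<Sum>j<N. (A j t + (\<Sum>s<m. g t s * p s j))\<^sup>2)" for t
  proof -
    have "(\<Sum>j<N. (A j t + (\<Sum>s<m. g t s * p s j))\<^sup>2)
        = (\<Sum>j<N. (A j t - (\<Sum>s<m. - g t s * p s j))\<^sup>2)"
      by (simp add: sum_negf)
    also have "\<dots> = (\<Sum>j<N. (A j t)\<^sup>2) + (\<Sum>s<m. 2 * (g t s * y s t) + (g t s)\<^sup>2 * c s)"
      by (subst orthogonal_family_expansion[of _ _ _ c])
        (auto simp: pp y_def sum_negf sum.distrib sum_distrib_left)
    finally have eq: "(\<Sum>j<N. (A j t + (\<Sum>s<m. g t s * p s j))\<^sup>2)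
      = (\<Sum>j<N. (A j t)\<^sup>2) + (\<Sum>s<m. 2 * (g t s * y s t) + (g t s)\<^sup>2 * c s)" .
    \<comment> \<open>Termwise completion of the square: for \<open>c s\<close> = 1 the gap is (g +
      y)^2; for \<open>c s\<close> = 0 the vector vanishes and both sides are 0.\<close>
    have "(\<Sum>s<m. - (y s t)\<^sup>2) \<le> (\<Sum>s<m. 2 * (g t s * y s t) + (g t s)\<^sup>2 * c s)"
    proof (rule sum_mono)
      fix s assume "s \<in> {..<m}"
      then have s: "s < m" by simp
      show "- (y s t)\<^sup>2 \<le> 2 * (g t s * y s t) + (g t s)\<^sup>2 * c s"
      proof (cases "c s = 0")
        case True
        then have "(\<Sum>j<N. p s j * p s j) = 0" using pp[OF s s] by simp
        then have "\<forall>j\<in>{..<N}. p s j * p s j = 0" by (subst (asm) sum_nonneg_eq_0_iff) auto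
        then have "y s t = 0" by (simp add: y_def)
        then show ?thesis using True by simp
      next
        case False
        then have "c s = 1" using c[OF s] by simp
        moreover have "0 \<le> (g t s + y s t)\<^sup>2" by simp
        ultimately show ?thesis by (simp add: power2_sum algebra_simps)
      qed
    qed
    then show ?thesis unfolding eq by (simp add: sum_negf)
  qed
  \<comment> \<open>Squared length of the projection of \<open>u i\<close> onto the span of the
    \<open>p s\<close>: at most 1 each by Bessel's inequality, at most \<open>m\<close> in total by
    Parseval.\<close>
  define w where "w i = (\<Sum>s<m. (\<Sum>j<N. u i j * p s j)\<^sup>2)" for i
  have w0: "0 \<le> w i" for i unfolding w_def by (intro sum_nonneg) auto
  have w1: "w i \<le> 1" if "i < N" for i
  proof -
    have "w i \<le> (\<Sum>j<N. (u i j)\<^sup>2)"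
      unfolding w_def using c by (intro Bessel_inequality[where c = c]) (auto simp: pp, fastforce)
    then show ?thesis using uu[OF that that] by (simp add: power2_eq_square)
  qed
  have "(\<Sum>i<N. w i) = (\<Sum>s<m. \<Sum>i<N. (\<Sum>j<N. u i j * p s j)\<^sup>2)"
    unfolding w_def by (rule sum.swap)
  also have "\<dots> = (\<Sum>s<m. c s)"
    by (intro sum.cong refl) (simp add: sum_squares_orthogonal_image[OF uu'] pp2)
  also have "\<dots> \<le> (\<Sum>s<m. 1)" using c by (intro sum_mono) fastforce
  finally have wm: "(\<Sum>i<N. w i) \<le> real m" by simp
  have "(\<Sum>t<T. \<Sum>s<m. (y s t)\<^sup>2) = (\<Sum>s<m. \<Sum>t<T. (y s t)\<^sup>2)"
    by (rule sum.swap)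
  also have "\<dots> = (\<Sum>s<m. \<Sum>i<N. d i * (\<Sum>j<N. u i j * p s j)\<^sup>2)"
    unfolding y_def by (intro sum.cong refl sum_squares_image[OF aa A])
  also have "\<dots> = (\<Sum>i<N. d i * w i)"
    by (subst sum.swap) (simp add: w_def sum_distrib_left)
  also have "\<dots> \<le> (\<Sum>i<min m N. d i)"
    by (rule weighted_sum_le_initial_sum[OF dnn dmono w0 w1 wm])
  finally have y: "(\<Sum>t<T. \<Sum>s<m. (y s t)\<^sup>2) \<le> (\<Sum>i<min m N. d i)" .
  have "(\<Sum>t<T. \<Sum>j<N. (A j t)\<^sup>2) = (\<Sum>t<T. \<Sum>i<N. (a i t)\<^sup>2)"
  proof (rule sum.cong[OF refl])
    fix t
    show "(\<Sum>j<N. (A j t)\<^sup>2) = (\<Sum>i<N. (a i t)\<^sup>2)"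
      using orthogonal_family_expansion[of "{..<N}" u "{..<N}" "\<lambda>_. 1" "\<lambda>_. 0" "\<lambda>i. a i t"] uu
      by (simp add: A)
  qed
  also have "\<dots> = (\<Sum>i<N. d i)"
    by (subst sum.swap) (simp add: power2_eq_square aa)
  finally have AA: "(\<Sum>t<T. \<Sum>j<N. (A j t)\<^sup>2) = (\<Sum>i<N. d i)" .
  have "(\<Sum>r\<in>{m + 1..min N T}. (sing_val r (to_mat N T A))\<^sup>2) = (\<Sum>i\<in>{m..<min N T}. d i)"
    by (rule sum_sing_val_squares[OF sv])
  also have "\<dots> \<le> (\<Sum>i\<in>{..<N} - {..<min m N}. d i)"
    using dnn by (intro sum_mono2) auto
  also have "\<dots> = (\<Sum>i<N. d i) - (\<Sum>i<min m N. d i)"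
    by (intro sum_diff) auto
  also have "\<dots> \<le> (\<Sum>t<T. (\<Sum>j<N. (A j t)\<^sup>2) - (\<Sum>s<m. (y s t)\<^sup>2))"
    using y AA by (simp add: sum_subtractf)
  also have "\<dots> \<le> (\<Sum>t<T. \<Sum>j<N. (A j t + (\<Sum>s<m. g t s * p s j))\<^sup>2)"
    by (rule sum_mono) (rule col)
  also have "\<dots> = (\<Sum>i<N. \<Sum>t<T. (A i t + (\<Sum>r<m. lam i r * f t r))\<^sup>2)"
    by (subst sum.swap) (simp add: g)
  finally show ?thesis .
qed

text \<open>Expanding the columns of the low-rank matrix in the system \<open>p\<close> brings in
  only the \<open>m\<close> vectors E' p_s, each of squared norm at most the squared spectral norm.
  Cauchy-Schwarz over the pairs (t, s) then produces the factor sqrt(m).\<close>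

lemma low_rank_inner_product_bound:
  fixes E lam f :: "nat \<Rightarrow> nat \<Rightarrow> real"
  assumes N: "N > 0"
  shows "\<bar>\<Sum>i<N. \<Sum>t<T. (\<Sum>r<m. lam i r * f t r) * E i t\<bar>
     \<le> sqrt (real m) * spec_norm (to_mat N T E) * sqrt (\<Sum>i<N. \<Sum>t<T. (\<Sum>r<m. lam i r * f t r)\<^sup>2)"
proof -
  obtain u a :: "nat \<Rightarrow> nat \<Rightarrow> real" and d :: "nat \<Rightarrow> real" where
    uu': "\<And>j l. j < N \<Longrightarrow> l < N \<Longrightarrow> (\<Sum>i<N. u i j * u i l) = (if j = l then 1 else 0)" and
    aa: "\<And>i k. i < N \<Longrightarrow> k < N \<Longrightarrow> (\<Sum>t<T. a i t * a k t) = (if i = k then d i else 0)" and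
    E: "\<And>j t. j < N \<Longrightarrow> E j t = (\<Sum>i<N. a i t * u i j)" and
    dnn: "\<And>i. i < N \<Longrightarrow> d i \<ge> 0" and
    dmono: "\<And>i k. i \<le> k \<Longrightarrow> k < N \<Longrightarrow> d k \<le> d i" and
    sv: "\<And>i. i < N \<Longrightarrow> (sing_val (Suc i) (to_mat N T E))\<^sup>2 = d i" and
    sv0: "\<And>i. i < N \<Longrightarrow> sing_val (Suc i) (to_mat N T E) \<ge> 0"
    by (rule singular_value_decomposition[where N = N and T = T and A = E]) blast
  have sn: "(spec_norm (to_mat N T E))\<^sup>2 = d 0" "spec_norm (to_mat N T E) \<ge> 0"
    using sv[OF N] sv0[OF N] by (simp_all add: spec_norm_def)
  obtain p c g where
    pp: "\<And>s r. s < m \<Longrightarrow> r < m \<Longrightarrow> (\<Sum>j<N. p s j * p r j) = (if s = r then c s else (0::real))" and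
    c: "\<And>s. s < m \<Longrightarrow> c s = 0 \<or> c s = (1::real)" and
    g: "\<And>j t. j < N \<Longrightarrow> (\<Sum>r<m. lam j r * f t r) = (\<Sum>s<m. g t s * p s j)"
    using Gram_Schmidt_factorization[of m N lam f] by blast
  have pp2: "(\<Sum>j<N. (p s j)\<^sup>2) = c s" if "s < m" for s
    using pp[OF that that] by (simp add: power2_eq_square)
  define h where "h s t = (\<Sum>j<N. E j t * p s j)" for s t
  \<comment> \<open>Coefficients attached to zero vectors are arbitrary and invisible in the
    Frobenius norm; multiplying them by \<open>c s\<close> removes them without changing the inner
    product.\<close>
  have ch: "c s * h s t = h s t" if s: "s < m" for s t
  proof (cases "c s = 0")
    case True
    then have "(\<Sum>j<N. p s j * p s j) = 0" using pp[OF s s] by simp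
    then have "\<forall>j\<in>{..<N}. p s j * p s j = 0" by (subst (asm) sum_nonneg_eq_0_iff) auto
    then have "h s t = 0" by (simp add: h_def)
    then show ?thesis by simp
  qed (use c[OF s] in auto)
  have "(\<Sum>i<N. \<Sum>t<T. (\<Sum>r<m. lam i r * f t r) * E i t) = (\<Sum>i<N. \<Sum>t<T. \<Sum>s<m. g t s * (E i t * p s i))"
    by (simp add: g sum_distrib_right mult.assoc mult.commute[of "p _ _"])
  also have "\<dots> = (\<Sum>t<T. \<Sum>s<m. \<Sum>i<N. g t s * (E i t * p s i))"
    by (rule sum_rotate)
  also have "\<dots> = (\<Sum>t<T. \<Sum>s<m. (c s * g t s) * h s t)"
    by (intro sum.cong refl) (simp add: h_def[symmetric] sum_distrib_left[symmetric] ch mult.assoc mult.left_commute[of "c _"])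
  also have "\<dots> = (\<Sum>(t,s)\<in>{..<T}\<times>{..<m}. (c s * g t s) * h s t)"
    by (rule sum.cartesian_product)
  finally have 1: "(\<Sum>i<N. \<Sum>t<T. (\<Sum>r<m. lam i r * f t r) * E i t)
    = (\<Sum>(t,s)\<in>{..<T}\<times>{..<m}. (c s * g t s) * h s t)" .
  have "(\<Sum>i<N. \<Sum>t<T. (\<Sum>r<m. lam i r * f t r)\<^sup>2) = (\<Sum>t<T. \<Sum>j<N. (\<Sum>s<m. g t s * p s j)\<^sup>2)"
    by (subst sum.swap) (simp add: g)
  also have "\<dots> = (\<Sum>t<T. \<Sum>s<m. (c s * g t s)\<^sup>2)"
  proof (rule sum.cong[OF refl])
    fix t
    have "(\<Sum>j<N. (\<Sum>s<m. g t s * p s j)\<^sup>2) = (\<Sum>s<m. (g t s)\<^sup>2 * c s)"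
      using orthogonal_family_expansion[of "{..<m}" p "{..<N}" c "\<lambda>_. 0" "\<lambda>s. g t s"] pp by simp
    also have "\<dots> = (\<Sum>s<m. (c s * g t s)\<^sup>2)"
      using c by (intro sum.cong refl) fastforce
    finally show "(\<Sum>j<N. (\<Sum>s<m. g t s * p s j)\<^sup>2) = (\<Sum>s<m. (c s * g t s)\<^sup>2)" .
  qed
  finally have 2: "(\<Sum>i<N. \<Sum>t<T. (\<Sum>r<m. lam i r * f t r)\<^sup>2)
      = (\<Sum>(t,s)\<in>{..<T}\<times>{..<m}. (c s * g t s)\<^sup>2)"
    by (simp add: sum.cartesian_product)
  have "(\<Sum>(t,s)\<in>{..<T}\<times>{..<m}. (h s t)\<^sup>2) = (\<Sum>s<m. \<Sum>t<T. (h s t)\<^sup>2)"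
    by (simp add: sum.cartesian_product[symmetric]) (rule sum.swap)
  also have "\<dots> \<le> (\<Sum>s<m. d 0)"
  proof (rule sum_mono)
    fix s assume "s \<in> {..<m}"
    then have s: "s < m" by simp
    have "(\<Sum>t<T. (h s t)\<^sup>2) = (\<Sum>i<N. d i * (\<Sum>j<N. u i j * p s j)\<^sup>2)"
      unfolding h_def by (rule sum_squares_image[OF aa E])
    also have "\<dots> \<le> (\<Sum>i<N. d 0 * (\<Sum>j<N. u i j * p s j)\<^sup>2)"
      using dmono by (intro sum_mono mult_right_mono) auto
    also have "\<dots> = d 0 * c s"
      by (simp add: sum_distrib_left[symmetric] sum_squares_orthogonal_image[OF uu'] pp2 s)
    also have "\<dots> \<le> d 0" using c[OF s] dnn[OF N] by auto
    finally show "(\<Sum>t<T. (h s t)\<^sup>2) \<le> d 0" .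
  qed
  also have "\<dots> = real m * (spec_norm (to_mat N T E))\<^sup>2" by (simp add: sn)
  finally have 3: "(\<Sum>(t,s)\<in>{..<T}\<times>{..<m}. (h s t)\<^sup>2) \<le> real m * (spec_norm (to_mat N T E))\<^sup>2" .
  have "(\<Sum>(t,s)\<in>{..<T}\<times>{..<m}. (c s * g t s) * h s t)\<^sup>2
     \<le> (\<Sum>(t,s)\<in>{..<T}\<times>{..<m}. (c s * g t s)\<^sup>2) * (\<Sum>(t,s)\<in>{..<T}\<times>{..<m}. (h s t)\<^sup>2)"
    using Cauchy_Schwarz_ineq_sum[of "\<lambda>(t,s). c s * g t s" "\<lambda>(t,s). h s t" "{..<T}\<times>{..<m}"]
    by (simp add: case_prod_unfold)
  also have "\<dots> \<le> (\<Sum>(t,s)\<in>{..<T}\<times>{..<m}. (c s * g t s)\<^sup>2) * (real m * (spec_norm (to_mat N T E))\<^sup>2)"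
    by (intro mult_left_mono 3 sum_nonneg) auto
  finally have "sqrt ((\<Sum>(t,s)\<in>{..<T}\<times>{..<m}. (c s * g t s) * h s t)\<^sup>2)
     \<le> sqrt ((\<Sum>(t,s)\<in>{..<T}\<times>{..<m}. (c s * g t s)\<^sup>2) * (real m * (spec_norm (to_mat N T E))\<^sup>2))"
    by (rule real_sqrt_le_mono)
  then show ?thesis
    unfolding 1 2 using sn(2) by (simp add: real_sqrt_mult mult_ac)
qed

section \<open>The deterministic estimation error bound\<close>

definition frob :: "nat \<Rightarrow> nat \<Rightarrow> (nat \<Rightarrow> nat \<Rightarrow> real) \<Rightarrow> real" where
  "frob N T A = sqrt (\<Sum>i<N. \<Sum>t<T. (A i t)\<^sup>2)"

text \<open>Flattening the double sum lets \<open>frob\<close> inherit the triangle and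
  Cauchy-Schwarz inequalities of \<open>L2_set\<close>.\<close>

lemma frob_L2_set: "frob N T A = L2_set (\<lambda>(i,t). A i t) ({..<N} \<times> {..<T})"
  by (simp add: frob_def L2_set_def sum.cartesian_product case_prod_unfold)

lemma frob_nonneg: "frob N T A \<ge> 0"
  by (simp add: frob_L2_set L2_set_nonneg)

lemma frob_power2: "(frob N T A)\<^sup>2 = (\<Sum>i<N. \<Sum>t<T. (A i t)\<^sup>2)"
  by (simp add: frob_def sum_nonneg)

lemma frob_Cauchy_Schwarz: "(\<Sum>i<N. \<Sum>t<T. A i t * B i t) \<le> frob N T A * frob N T B"
proof -
  have "(\<Sum>i<N. \<Sum>t<T. A i t * B i t) = (\<Sum>x\<in>{..<N} \<times> {..<T}. (case x of (i,t) \<Rightarrow> A i t) * (case x of (i,t) \<Rightarrow> B i t))"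
    by (simp add: sum.cartesian_product case_prod_unfold)
  also have "\<dots> \<le> (\<Sum>x\<in>{..<N} \<times> {..<T}. \<bar>case x of (i,t) \<Rightarrow> A i t\<bar> * \<bar>case x of (i,t) \<Rightarrow> B i t\<bar>)"
    by (intro sum_mono) (metis abs_ge_self abs_mult)
  also have "\<dots> \<le> frob N T A * frob N T B"
    unfolding frob_L2_set by (rule L2_set_mult_ineq)
  finally show ?thesis .
qed

lemma frob_diff_triangle: "frob N T (\<lambda>i t. A i t - B i t) \<le> frob N T A + frob N T B"
proof -
  have "frob N T (\<lambda>i t. A i t - B i t) = L2_set (\<lambda>x. (case x of (i,t) \<Rightarrow> A i t) + (case x of (i,t) \<Rightarrow> - B i t)) ({..<N} \<times> {..<T})"
    by (simp add: frob_L2_set case_prod_unfold)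
  also have "\<dots> \<le> frob N T A + L2_set (\<lambda>(i,t). - B i t) ({..<N} \<times> {..<T})"
    unfolding frob_L2_set by (rule L2_set_triangle_ineq)
  also have "L2_set (\<lambda>(i,t). - B i t) ({..<N} \<times> {..<T}) = frob N T B"
    by (simp add: frob_L2_set L2_set_def case_prod_unfold)
  finally show ?thesis .
qed

lemma spec_norm_nonneg:
  assumes "N > 0" shows "spec_norm (to_mat N T A) \<ge> 0"
  by (rule singular_value_decomposition[where N = N and T = T and A = A])
    (use assms in \<open>simp add: spec_norm_def\<close>)

section \<open>The least-squares comparison\<close>

lemma LS_obj_le:
  "LS_obj N T R Y X \<beta> \<le> (\<Sum>i<N. \<Sum>t<T. (Y i t - X i t \<bullet> \<beta> - (\<Sum>r<R. lam i r * f t r))\<^sup>2)"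
  unfolding LS_obj_def by (rule cInf_lower) (auto intro!: bdd_belowI[of _ 0] sum_nonneg)

text \<open>Attainment of the infimum over factors is never established; factors within \<eta> of it
  take the place of minimizers.\<close>

lemma LS_obj_approx:
  assumes "\<eta> > 0"
  obtains lam f where "(\<Sum>i<N. \<Sum>t<T. (Y i t - X i t \<bullet> \<beta> - (\<Sum>r<R. lam i r * f t r))\<^sup>2) < LS_obj N T R Y X \<beta> + \<eta>"
proof -
  have "\<exists>z\<in>{(\<Sum>i<N. \<Sum>t<T. (Y i t - X i t \<bullet> \<beta> - (\<Sum>r<R. lam i r * f t r))\<^sup>2)
          | lam f :: nat \<Rightarrow> nat \<Rightarrow> real. True}. z < LS_obj N T R Y X \<beta> + \<eta>"
    using assms by (intro cInf_lessD) (auto simp: LS_obj_def)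
  then show thesis using that by auto
qed

text \<open>Condition (3) speaks of unit directions and normalized regressors. Dividing the whole
  matrix by \<open>q\<close> brings the claim to that form: the low-rank part absorbs the factor
  into \<open>lam\<close>, and the Eckart-Young lower bound applies.\<close>

lemma low_rank_perturbation_lower_bound:
  fixes X :: "nat \<Rightarrow> nat \<Rightarrow> real^'k" and lam f :: "nat \<Rightarrow> nat \<Rightarrow> real"
  assumes NT: "N > 0" "T > 0" and b: "b > 0"
    and A3: "\<And>\<delta>::real^'k. norm \<delta> = 1 \<Longrightarrow> b \<le> (\<Sum>r\<in>{m + 1..min N T}.
        (sing_val r (to_mat N T (\<lambda>i t. (\<delta> \<bullet> X i t) / sqrt (real N * real T))))\<^sup>2)"
  shows "norm \<delta> * sqrt (b * (real N * real T)) \<le> frob N T (\<lambda>i t. X i t \<bullet> \<delta> + (\<Sum>r<m. lam i r * f t r))"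
proof (cases "\<delta> = 0")
  case True
  then show ?thesis by (simp add: frob_nonneg)
next
  case False
  define q where "q = norm \<delta> * sqrt (real N * real T)"
  have q: "q > 0" using False NT by (simp add: q_def)
  have "norm (\<delta> /\<^sub>R norm \<delta>) = 1" using False by simp
  from A3[OF this] have "b \<le> (\<Sum>i<N. \<Sum>t<T. (((\<delta> /\<^sub>R norm \<delta>) \<bullet> X i t) / sqrt (real N * real T)
        + (\<Sum>r<m. lam i r / q * f t r))\<^sup>2)"
    by (rule order_trans[OF _ low_rank_approximation_lower_bound])
  also have "\<dots> = (\<Sum>i<N. \<Sum>t<T. (X i t \<bullet> \<delta> + (\<Sum>r<m. lam i r * f t r))\<^sup>2 / q\<^sup>2)"
  proof (intro sum.cong refl)
    fix i t
    have "((\<delta> /\<^sub>R norm \<delta>) \<bullet> X i t) / sqrt (real N * real T) = (X i t \<bullet> \<delta>) / q"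
      by (simp add: q_def inner_commute divide_inverse mult_ac)
    moreover have "(\<Sum>r<m. lam i r / q * f t r) = (\<Sum>r<m. lam i r * f t r) / q"
      by (simp add: sum_divide_distrib)
    ultimately show "(((\<delta> /\<^sub>R norm \<delta>) \<bullet> X i t) / sqrt (real N * real T) + (\<Sum>r<m. lam i r / q * f t r))\<^sup>2
      = (X i t \<bullet> \<delta> + (\<Sum>r<m. lam i r * f t r))\<^sup>2 / q\<^sup>2"
      by (simp add: add_divide_distrib[symmetric] power_divide)
  qed
  also have "\<dots> = (frob N T (\<lambda>i t. X i t \<bullet> \<delta> + (\<Sum>r<m. lam i r * f t r)))\<^sup>2 / q\<^sup>2"
    by (simp add: frob_power2 sum_divide_distrib)
  finally have "b * q\<^sup>2 \<le> (frob N T (\<lambda>i t. X i t \<bullet> \<delta> + (\<Sum>r<m. lam i r * f t r)))\<^sup>2"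
    using q by (simp add: pos_le_divide_eq)
  then have "sqrt (b * q\<^sup>2) \<le> frob N T (\<lambda>i t. X i t \<bullet> \<delta> + (\<Sum>r<m. lam i r * f t r))"
    using frob_nonneg by (intro real_le_lsqrt) auto
  moreover have "sqrt (b * q\<^sup>2) = norm \<delta> * sqrt (b * (real N * real T))"
    using q b by (simp add: real_sqrt_mult q_def)
  ultimately show ?thesis by simp
qed

text \<open>If v exceeded the bound, both v and v - \<kappa> would exceed \<eta>, so v (v -
  \<kappa>) > \<eta>^2. The slack enters squared in order to come out linear.\<close>

lemma le_of_square_le:
  fixes v \<kappa> \<eta> :: real
  assumes "v\<^sup>2 \<le> \<kappa> * v + \<eta>\<^sup>2" "\<eta> > 0" "\<kappa> \<ge> 0"
  shows "v \<le> \<kappa> + \<eta>"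
proof (rule ccontr)
  assume "\<not> v \<le> \<kappa> + \<eta>"
  then have *: "v - \<kappa> > \<eta>" "v > \<eta>" using assms by auto
  then have "\<eta> * \<eta> < v * (v - \<kappa>)" using assms by (intro mult_strict_mono) auto
  then show False using assms(1) by (simp add: power2_eq_square algebra_simps)
qed

lemma inner_product_regressor_bound:
  fixes X :: "nat \<Rightarrow> nat \<Rightarrow> real^'k"
  assumes S: "\<And>k. \<bar>\<Sum>i<N. \<Sum>t<T. X i t $ k * e i t\<bar> \<le> S"
  shows "(\<Sum>i<N. \<Sum>t<T. (X i t \<bullet> \<delta>) * e i t) \<le> norm \<delta> * (real CARD('k) * S)"
proof -
  have "(\<Sum>i<N. \<Sum>t<T. (X i t \<bullet> \<delta>) * e i t) = (\<Sum>i<N. \<Sum>t<T. \<Sum>k\<in>UNIV. \<delta> $ k * (X i t $ k * e i t))"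
    unfolding inner_vec_def sum_distrib_right by (simp add: mult_ac)
  also have "\<dots> = (\<Sum>k\<in>UNIV. \<Sum>i<N. \<Sum>t<T. \<delta> $ k * (X i t $ k * e i t))"
    by (rule sum_rotate[symmetric])
  also have "\<dots> = (\<Sum>k\<in>UNIV. \<delta> $ k * (\<Sum>i<N. \<Sum>t<T. X i t $ k * e i t))"
    by (simp add: sum_distrib_left)
  also have "\<dots> \<le> (\<Sum>k\<in>(UNIV::'k set). norm \<delta> * S)"
  proof (rule sum_mono)
    fix k
    have "\<delta> $ k * (\<Sum>i<N. \<Sum>t<T. X i t $ k * e i t) \<le> \<bar>\<delta> $ k\<bar> * \<bar>\<Sum>i<N. \<Sum>t<T. X i t $ k * e i t\<bar>"
      by (simp only: abs_mult[symmetric] abs_ge_self)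
    also have "\<dots> \<le> norm \<delta> * S"
      by (intro mult_mono component_le_norm_cart S) auto
    finally show "\<delta> $ k * (\<Sum>i<N. \<Sum>t<T. X i t $ k * e i t) \<le> norm \<delta> * S" .
  qed
  finally show ?thesis by (simp add: mult.left_commute)
qed

text \<open>Needed to pass from V to its low-rank part, which is V minus this matrix.\<close>

lemma frob_regressor_bound:
  fixes X :: "nat \<Rightarrow> nat \<Rightarrow> real^'k"
  assumes XX: "\<And>k. (\<Sum>i<N. \<Sum>t<T. (X i t $ k)\<^sup>2) \<le> Z"
  shows "frob N T (\<lambda>i t. X i t \<bullet> \<delta>) \<le> norm \<delta> * sqrt (real CARD('k) * Z)"
proof -
  have "(\<Sum>i<N. \<Sum>t<T. (X i t \<bullet> \<delta>)\<^sup>2) \<le> (\<Sum>i<N. \<Sum>t<T. \<Sum>k\<in>UNIV. (norm \<delta>)\<^sup>2 * (X i t $ k)\<^sup>2)"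
  proof (intro sum_mono)
    fix i t
    have "(X i t \<bullet> \<delta>)\<^sup>2 \<le> (norm (X i t) * norm \<delta>)\<^sup>2"
      using Cauchy_Schwarz_ineq2[of "X i t" \<delta>] by (metis abs_ge_zero power2_abs power_mono)
    also have "\<dots> = (norm \<delta>)\<^sup>2 * (\<Sum>k\<in>UNIV. (X i t $ k)\<^sup>2)"
      by (simp add: norm_vec_def L2_set_def power_mult_distrib sum_nonneg)
    finally show "(X i t \<bullet> \<delta>)\<^sup>2 \<le> (\<Sum>k\<in>UNIV. (norm \<delta>)\<^sup>2 * (X i t $ k)\<^sup>2)"
      by (simp add: sum_distrib_left)
  qed
  also have "\<dots> = (\<Sum>k\<in>UNIV. (norm \<delta>)\<^sup>2 * (\<Sum>i<N. \<Sum>t<T. (X i t $ k)\<^sup>2))"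
    by (subst sum_rotate[symmetric]) (simp add: sum_distrib_left)
  also have "\<dots> \<le> (\<Sum>k\<in>(UNIV::'k set). (norm \<delta>)\<^sup>2 * Z)"
    by (intro sum_mono mult_left_mono XX) auto
  finally have "(\<Sum>i<N. \<Sum>t<T. (X i t \<bullet> \<delta>)\<^sup>2) \<le> (norm \<delta>)\<^sup>2 * (real CARD('k) * Z)"
    by (simp add: mult_ac)
  then have "frob N T (\<lambda>i t. X i t \<bullet> \<delta>) \<le> sqrt ((norm \<delta>)\<^sup>2 * (real CARD('k) * Z))"
    unfolding frob_def by (rule real_sqrt_le_mono)
  then show ?thesis by (simp add: real_sqrt_mult)
qed

text \<open>\<open>G\<close>, \<open>E\<close>, \<open>S\<close> and \<open>Z\<close> bound the tail
  of \<Gamma>, the noise norm, the scores and the unnormalized second moments of the regressors. The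
  factor 1 + sqrt(K Z) / q is the price of replacing the norm of L - Gamma_1 by |V|, using |delta|
  \<le> |V| / q.\<close>

lemma LS_estimation_error_bound:
  fixes X :: "nat \<Rightarrow> nat \<Rightarrow> real^'k" and \<beta>h \<beta>0 :: "real^'k"
    and Y \<Gamma> e :: "nat \<Rightarrow> nat \<Rightarrow> real"
  assumes NT: "N > 0" "T > 0" and b: "b > 0"
    and model: "\<And>i t. i < N \<Longrightarrow> t < T \<Longrightarrow> Y i t = X i t \<bullet> \<beta>0 + \<Gamma> i t + e i t"
    and LS: "LS_obj N T R Y X \<beta>h \<le> LS_obj N T R Y X \<beta>0"
    and A3: "\<And>\<delta>::real^'k. norm \<delta> = 1 \<Longrightarrow> b \<le> (\<Sum>r\<in>{2 * R + 1..min N T}.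
        (sing_val r (to_mat N T (\<lambda>i t. (\<delta> \<bullet> X i t) / sqrt (real N * real T))))\<^sup>2)"
    and G: "(\<Sum>r\<in>{R + 1..min N T}. (sing_val r (to_mat N T \<Gamma>))\<^sup>2) \<le> G\<^sup>2" "G \<ge> 0"
    and E: "spec_norm (to_mat N T e) \<le> E"
    and S: "\<And>k. \<bar>\<Sum>i<N. \<Sum>t<T. X i t $ k * e i t\<bar> \<le> S"
    and XX: "\<And>k. (\<Sum>i<N. \<Sum>t<T. (X i t $ k)\<^sup>2) \<le> Z"
  defines "q \<equiv> sqrt (b * (real N * real T))"
  shows "norm (\<beta>h - \<beta>0) * q \<le> 2 * G + 2 * (real CARD('k) * S) / q
           + 2 * (sqrt (2 * real R) * E) * (1 + sqrt (real CARD('k) * Z) / q)"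
\<comment> \<open>Near-minimizing factors cost \<eta>^2 in the objective and therefore \<eta> in the
  bound, for every positive \<eta>.\<close>
proof (rule field_le_epsilon)
  fix \<eta> :: real assume \<eta>: "\<eta> > 0"
  define \<delta> where "\<delta> = \<beta>h - \<beta>0"
  define K where "K = real CARD('k)"
  define \<kappa> where "\<kappa> = 2 * G + 2 * (K * S) / q + 2 * (sqrt (2 * real R) * E) * (1 + sqrt (K * Z) / q)"
  have q: "q > 0" using NT b by (simp add: q_def)
  have E0: "E \<ge> 0" using spec_norm_nonneg[OF NT(1)] E order_trans by blast
  have S0: "S \<ge> 0" using S abs_ge_zero order_trans by blast
  have "0 \<le> (\<Sum>i<N. \<Sum>t<T. (X i t $ k)\<^sup>2)" for k by (intro sum_nonneg) auto
  then have Z0: "Z \<ge> 0" using XX order_trans by blast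
  have \<kappa>: "\<kappa> \<ge> 0" using G(2) S0 E0 Z0 q by (simp add: \<kappa>_def K_def)
  obtain lam f where L: "(\<Sum>i<N. \<Sum>t<T. (Y i t - X i t \<bullet> \<beta>h - (\<Sum>r<R. lam i r * f t r))\<^sup>2)
      < LS_obj N T R Y X \<beta>h + \<eta>\<^sup>2"
    by (rule LS_obj_approx[where \<eta> = "\<eta>\<^sup>2"]) (use \<eta> in auto)
  obtain lam1 f1 where "(\<Sum>i<N. \<Sum>t<T. (\<Gamma> i t - (\<Sum>r<R. lam1 i r * f1 t r))\<^sup>2)
      \<le> (\<Sum>r\<in>{R + 1..min N T}. (sing_val r (to_mat N T \<Gamma>))\<^sup>2)"
    by (rule low_rank_approximation)
  note L1 = order_trans[OF this G(1)]
  define \<Gamma>2 where "\<Gamma>2 i t = \<Gamma> i t - (\<Sum>r<R. lam1 i r * f1 t r)" for i t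
  \<comment> \<open>The two rank-\<open>R\<close> sums are concatenated, the second with a minus
    sign, so that L - Gamma_1 becomes a single sum of 2R products.\<close>
  define lam' where "lam' i r = (if r < R then lam i r else lam1 i (r - R))" for i r
  define f' where "f' t r = (if r < R then f t r else - f1 t (r - R))" for t r
  define P where "P i t = (\<Sum>r<2 * R. lam' i r * f' t r)" for i t
  define V where "V i t = X i t \<bullet> \<delta> + P i t" for i t
  define v where "v = frob N T V"
  have v: "v \<ge> 0" by (simp add: v_def frob_nonneg)
  have P: "P i t = (\<Sum>r<R. lam i r * f t r) - (\<Sum>r<R. lam1 i r * f1 t r)" for i t
  proof -
    have "{..<2 * R} = {..<R} \<union> {R..<R + R}" by auto
    then have "P i t = (\<Sum>r<R. lam' i r * f' t r) + (\<Sum>r\<in>{R..<R + R}. lam' i r * f' t r)"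
      unfolding P_def by (simp add: sum.union_disjoint ivl_disj_int)
    also have "(\<Sum>r\<in>{R..<R + R}. lam' i r * f' t r) = (\<Sum>r<R. lam' i (r + R) * f' t (r + R))"
      using sum.shift_bounds_nat_ivl[of "\<lambda>r. lam' i r * f' t r" 0 R R] by (simp add: atLeast0LessThan)
    finally show ?thesis by (simp add: lam'_def f'_def sum_negf)
  qed
  have G2: "frob N T \<Gamma>2 \<le> G"
    by (rule power2_le_imp_le[OF _ G(2)]) (use L1 in \<open>simp add: frob_power2 \<Gamma>2_def\<close>)
  \<comment> \<open>By the model, the residual at the estimator with factors L is Gamma_2 + eps -
    V.\<close>
  have "(\<Sum>i<N. \<Sum>t<T. (\<Gamma>2 i t + e i t - V i t)\<^sup>2)
      = (\<Sum>i<N. \<Sum>t<T. (Y i t - X i t \<bullet> \<beta>h - (\<Sum>r<R. lam i r * f t r))\<^sup>2)"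
    by (intro sum.cong refl arg_cong[where f = "\<lambda>x. x\<^sup>2"])
      (simp add: \<Gamma>2_def V_def P model \<delta>_def inner_diff_right)
  also have "\<dots> \<le> LS_obj N T R Y X \<beta>0 + \<eta>\<^sup>2" using L LS by simp
  also have "\<dots> \<le> (\<Sum>i<N. \<Sum>t<T. (Y i t - X i t \<bullet> \<beta>0 - (\<Sum>r<R. lam1 i r * f1 t r))\<^sup>2) + \<eta>\<^sup>2"
    by (intro add_right_mono LS_obj_le)
  also have "(\<Sum>i<N. \<Sum>t<T. (Y i t - X i t \<bullet> \<beta>0 - (\<Sum>r<R. lam1 i r * f1 t r))\<^sup>2)
      = (\<Sum>i<N. \<Sum>t<T. (\<Gamma>2 i t + e i t)\<^sup>2)"
    by (intro sum.cong refl arg_cong[where f = "\<lambda>x. x\<^sup>2"]) (simp add: \<Gamma>2_def model)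
  finally have ineq: "(\<Sum>i<N. \<Sum>t<T. (\<Gamma>2 i t + e i t - V i t)\<^sup>2) \<le> (\<Sum>i<N. \<Sum>t<T. (\<Gamma>2 i t + e i t)\<^sup>2) + \<eta>\<^sup>2" .
  \<comment> \<open>The square of Gamma_2 + eps will cancel against the objective at the true
    parameter. Gamma_2 stays paired with V, while eps is split over delta.X and \<open>P\<close>:
    the scores handle the first product, the spectral norm the second.\<close>
  have "(\<Sum>i<N. \<Sum>t<T. (\<Gamma>2 i t + e i t - V i t)\<^sup>2)
     = (\<Sum>i<N. \<Sum>t<T. (\<Gamma>2 i t + e i t)\<^sup>2 + (V i t)\<^sup>2 - 2 * (\<Gamma>2 i t * V i t)
         - 2 * ((X i t \<bullet> \<delta>) * e i t) - 2 * (P i t * e i t))"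
    by (intro sum.cong refl) (simp add: V_def power2_eq_square algebra_simps)
  also have "\<dots> = (\<Sum>i<N. \<Sum>t<T. (\<Gamma>2 i t + e i t)\<^sup>2) + v\<^sup>2 - 2 * (\<Sum>i<N. \<Sum>t<T. \<Gamma>2 i t * V i t)
      - 2 * (\<Sum>i<N. \<Sum>t<T. (X i t \<bullet> \<delta>) * e i t) - 2 * (\<Sum>i<N. \<Sum>t<T. P i t * e i t)"
    by (simp only: sum.distrib sum_subtractf sum_distrib_left[symmetric] v_def frob_power2)
  finally have main: "v\<^sup>2 \<le> 2 * (\<Sum>i<N. \<Sum>t<T. \<Gamma>2 i t * V i t)
      + 2 * (\<Sum>i<N. \<Sum>t<T. (X i t \<bullet> \<delta>) * e i t) + 2 * (\<Sum>i<N. \<Sum>t<T. P i t * e i t) + \<eta>\<^sup>2"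
    using ineq by simp
  have dv: "norm \<delta> \<le> v / q"
    using low_rank_perturbation_lower_bound[OF NT b A3, of "\<delta>" lam' f'] q
    by (simp add: q_def v_def V_def[abs_def] P_def pos_le_divide_eq)
  have 1: "(\<Sum>i<N. \<Sum>t<T. \<Gamma>2 i t * V i t) \<le> G * v"
    using frob_Cauchy_Schwarz[of \<Gamma>2 V T N] mult_right_mono[OF G2 v] by (simp add: v_def)
  have "(\<Sum>i<N. \<Sum>t<T. (X i t \<bullet> \<delta>) * e i t) \<le> norm \<delta> * (K * S)"
    unfolding K_def by (rule inner_product_regressor_bound[OF S])
  also have "\<dots> \<le> v / q * (K * S)"
    using dv S0 by (intro mult_right_mono) (auto simp: K_def)
  finally have 2: "(\<Sum>i<N. \<Sum>t<T. (X i t \<bullet> \<delta>) * e i t) \<le> v / q * (K * S)" .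
  have "frob N T P = frob N T (\<lambda>i t. V i t - X i t \<bullet> \<delta>)" by (simp add: V_def)
  also have "\<dots> \<le> v + frob N T (\<lambda>i t. X i t \<bullet> \<delta>)"
    unfolding v_def by (rule frob_diff_triangle)
  also have "\<dots> \<le> v + norm \<delta> * sqrt (K * Z)"
    unfolding K_def by (intro add_left_mono frob_regressor_bound XX)
  also have "\<dots> \<le> v + v / q * sqrt (K * Z)"
    using dv Z0 by (intro add_left_mono mult_right_mono) (auto simp: K_def)
  finally have Pv: "frob N T P \<le> v + v / q * sqrt (K * Z)" .
  have "(\<Sum>i<N. \<Sum>t<T. P i t * e i t) \<le> sqrt (real (2 * R)) * spec_norm (to_mat N T e) * frob N T P"
    unfolding P_def frob_def using low_rank_inner_product_bound[OF NT(1), where T = T and m = "2 * R" and lam = lam' and f = f' and E = e] by linarith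
  also have "\<dots> \<le> sqrt (2 * real R) * E * (v + v / q * sqrt (K * Z))"
    using Pv E E0 spec_norm_nonneg[OF NT(1), of T e] frob_nonneg[of N T P]
    by (intro mult_mono) auto
  finally have 3: "(\<Sum>i<N. \<Sum>t<T. P i t * e i t) \<le> sqrt (2 * real R) * E * (v + v / q * sqrt (K * Z))" .
  have "v\<^sup>2 \<le> 2 * (G * v) + 2 * (v / q * (K * S)) + 2 * (sqrt (2 * real R) * E * (v + v / q * sqrt (K * Z))) + \<eta>\<^sup>2"
    using main 1 2 3 by linarith
  also have "\<dots> = \<kappa> * v + \<eta>\<^sup>2"
    by (simp add: \<kappa>_def divide_inverse algebra_simps)
  finally have "v \<le> \<kappa> + \<eta>" using \<eta> \<kappa> by (rule le_of_square_le)
  moreover have "norm \<delta> * q \<le> v" using dv q by (simp add: pos_le_divide_eq)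
  ultimately show "norm (\<beta>h - \<beta>0) * q \<le> 2 * G + 2 * (real CARD('k) * S) / q
           + 2 * (sqrt (2 * real R) * E) * (1 + sqrt (real CARD('k) * Z) / q) + \<eta>"
    by (simp add: \<kappa>_def \<delta>_def K_def)
qed

section \<open>Stochastic orders and rates\<close>

text \<open>A strict bound on the infimum is witnessed by an actual measurable cover; monotonicity
  and the union bound then reduce to facts about covers.\<close>

lemma (in prob_space) outer_prob_less_iff:
  "outer_prob M A < e \<longleftrightarrow> (\<exists>B\<in>sets M. A \<inter> space M \<subseteq> B \<and> measure M B < e)"
proof -
  have "outer_prob M A < e \<longleftrightarrow> (\<exists>x\<in>{measure M B | B. B \<in> sets M \<and> A \<inter> space M \<subseteq> B}. x < e)"
    unfolding outer_prob_def
  proof (rule cInf_less_iff)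
    show "{measure M B | B. B \<in> sets M \<and> A \<inter> space M \<subseteq> B} \<noteq> {}"
      by (auto intro!: exI[of _ "space M"])
    show "bdd_below {measure M B | B. B \<in> sets M \<and> A \<inter> space M \<subseteq> B}"
      by (auto intro!: bdd_belowI[of _ 0])
  qed
  then show ?thesis by auto
qed

lemma (in prob_space) outer_prob_less_mono:
  "outer_prob M B < e \<Longrightarrow> A \<inter> space M \<subseteq> B \<Longrightarrow> outer_prob M A < e"
  unfolding outer_prob_less_iff by blast

lemma (in prob_space) outer_prob_UN_less:
  assumes "finite I" "I \<noteq> {}" "\<And>k. k \<in> I \<Longrightarrow> outer_prob M (A k) < e k"
  shows "outer_prob M (\<Union>k\<in>I. A k) < (\<Sum>k\<in>I. e k)"
proof -
  have "\<forall>k\<in>I. \<exists>B\<in>sets M. A k \<inter> space M \<subseteq> B \<and> measure M B < e k"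
    using assms(3) by (simp add: outer_prob_less_iff)
  then obtain B where B: "\<And>k. k \<in> I \<Longrightarrow> B k \<in> sets M \<and> A k \<inter> space M \<subseteq> B k \<and> measure M (B k) < e k"
    by metis
  have "measure M (\<Union>k\<in>I. B k) \<le> (\<Sum>k\<in>I. measure M (B k))"
    using assms(1) B by (intro measure_UNION_le) auto
  also have "\<dots> < (\<Sum>k\<in>I. e k)"
    using assms B by (intro sum_strict_mono) auto
  finally show ?thesis
    unfolding outer_prob_less_iff using assms(1) B by (intro bexI[of _ "\<Union>k\<in>I. B k"]) blast+
qed

lemma (in prob_space) outer_prob_Un_less:
  assumes "outer_prob M A < e" "outer_prob M B < e'"
  shows "outer_prob M (A \<union> B) < e + e'"
  using outer_prob_UN_less[of UNIV "\<lambda>b. if b then A else B" "\<lambda>b. if b then e else e'"] assms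
  by (simp add: UNIV_bool Un_commute add.commute)

text \<open>\<open>bigO_P\<close> admits any real constant, whereas the rate computation wants
  positive ones. Enlarging the constant is harmless because a n \<ge> 0.\<close>

lemma bigO_P_bounded:
  assumes prob: "\<And>n. prob_space (M n)" and Z: "bigO_P F M Z a" and a: "\<And>n. a n \<ge> 0" and e: "e > 0"
  obtains C where "C > 0"
    "eventually (\<lambda>n. outer_prob (M n) {\<omega> \<in> space (M n). \<not> \<bar>Z n \<omega>\<bar> \<le> C * a n} < e) F"
proof -
  obtain C where C: "eventually (\<lambda>n. outer_prob (M n) {\<omega> \<in> space (M n). \<bar>Z n \<omega>\<bar> > C * a n} < e) F"
    using Z e by (auto simp: bigO_P_def)
  have le: "C * a n \<le> max C 1 * a n" for n using a by (intro mult_right_mono) auto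
  show thesis
  proof (rule that[of "max C 1"])
    show "eventually (\<lambda>n. outer_prob (M n) {\<omega> \<in> space (M n). \<not> \<bar>Z n \<omega>\<bar> \<le> max C 1 * a n} < e) F"
      using C
    proof (rule eventually_mono)
      fix n assume *: "outer_prob (M n) {\<omega> \<in> space (M n). \<bar>Z n \<omega>\<bar> > C * a n} < e"
      interpret prob_space "M n" by (rule prob)
      show "outer_prob (M n) {\<omega> \<in> space (M n). \<not> \<bar>Z n \<omega>\<bar> \<le> max C 1 * a n} < e"
        by (rule outer_prob_less_mono[OF *]) (use le[of n] in auto)
    qed
  qed simp
qed

text \<open>One constant and one exceptional set for all regressors: the budget \<open>e\<close> is
  divided by their number, and \<open>D\<close>, the sum of the constants, dominates each of
  them.\<close>

lemma bigO_P_bounded_finite: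
  fixes Z :: "'k::finite \<Rightarrow> 'i \<Rightarrow> 'a \<Rightarrow> real"
  assumes prob: "\<And>n. prob_space (M n)" and Z: "\<And>k. bigO_P F M (Z k) a" and a: "\<And>n. a n \<ge> 0" and e: "e > 0"
  obtains C where "C > 0"
    "eventually (\<lambda>n. outer_prob (M n) {\<omega> \<in> space (M n). \<not> (\<forall>k. \<bar>Z k n \<omega>\<bar> \<le> C * a n)} < e) F"
proof -
  define e' where "e' = e / real CARD('k)"
  have e': "e' > 0" using e by (simp add: e'_def)
  have "\<exists>C>0. eventually (\<lambda>n. outer_prob (M n) {\<omega> \<in> space (M n). \<not> \<bar>Z k n \<omega>\<bar> \<le> C * a n} < e') F" for k
    by (rule bigO_P_bounded[OF prob Z[of k] a e']) (intro exI conjI)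
  then have "\<exists>C. \<forall>k. C k > 0 \<and>
      eventually (\<lambda>n. outer_prob (M n) {\<omega> \<in> space (M n). \<not> \<bar>Z k n \<omega>\<bar> \<le> C k * a n} < e') F"
    by (intro choice allI)
  then obtain C where C: "\<And>k. C k > 0"
    "\<And>k. eventually (\<lambda>n. outer_prob (M n) {\<omega> \<in> space (M n). \<not> \<bar>Z k n \<omega>\<bar> \<le> C k * a n} < e') F"
    by blast
  define D where "D = (\<Sum>k\<in>UNIV. C k)"
  have CD: "C k \<le> D" for k unfolding D_def using C(1) by (intro member_le_sum) (auto intro: less_imp_le)
  have le: "C k * a n \<le> D * a n" for k n using CD a by (intro mult_right_mono)
  show thesis
  proof (rule that[of D])
    show "D > 0" using C(1) CD less_le_trans by blast
    have "eventually (\<lambda>n. \<forall>k. outer_prob (M n) {\<omega> \<in> space (M n). \<not> \<bar>Z k n \<omega>\<bar> \<le> C k * a n} < e') F"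
      using C(2) by (simp add: eventually_all_finite)
    then show "eventually (\<lambda>n. outer_prob (M n) {\<omega> \<in> space (M n). \<not> (\<forall>k. \<bar>Z k n \<omega>\<bar> \<le> D * a n)} < e) F"
    proof (rule eventually_mono)
      fix n assume *: "\<forall>k. outer_prob (M n) {\<omega> \<in> space (M n). \<not> \<bar>Z k n \<omega>\<bar> \<le> C k * a n} < e'"
      interpret prob_space "M n" by (rule prob)
      have "outer_prob (M n) (\<Union>k. {\<omega> \<in> space (M n). \<not> \<bar>Z k n \<omega>\<bar> \<le> C k * a n}) < (\<Sum>k\<in>(UNIV::'k set). e')"
        using * by (intro outer_prob_UN_less) auto
      also have "\<dots> = e" by (simp add: e'_def)
      finally have "outer_prob (M n) (\<Union>k. {\<omega> \<in> space (M n). \<not> \<bar>Z k n \<omega>\<bar> \<le> C k * a n}) < e" .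
      then show "outer_prob (M n) {\<omega> \<in> space (M n). \<not> (\<forall>k. \<bar>Z k n \<omega>\<bar> \<le> D * a n)} < e"
      proof (rule outer_prob_less_mono)
        show "{\<omega> \<in> space (M n). \<not> (\<forall>k. \<bar>Z k n \<omega>\<bar> \<le> D * a n)} \<inter> space (M n)
          \<subseteq> (\<Union>k. {\<omega> \<in> space (M n). \<not> \<bar>Z k n \<omega>\<bar> \<le> C k * a n})"
          using le[of _ n] by (auto simp: not_le intro: le_less_trans)
      qed
    qed
  qed
qed

text \<open>The complement of a measurable set inside the event, of probability above 1 - e, covers
  the failure.\<close>

lemma wpa1_outer_prob_less:
  assumes prob: "\<And>n. prob_space (M n)" and E: "wpa1 F M E" and e: "e > 0"
  shows "eventually (\<lambda>n. outer_prob (M n) {\<omega> \<in> space (M n). \<not> E n \<omega>} < e) F"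
proof -
  have "eventually (\<lambda>n. inner_prob (M n) {\<omega> \<in> space (M n). E n \<omega>} > 1 - e) F"
    using E e unfolding wpa1_def by (intro order_tendstoD(1)) auto
  then show ?thesis
  proof (rule eventually_mono)
    fix n assume *: "inner_prob (M n) {\<omega> \<in> space (M n). E n \<omega>} > 1 - e"
    interpret prob_space "M n" by (rule prob)
    obtain B where B: "B \<in> sets (M n)" "B \<subseteq> {\<omega> \<in> space (M n). E n \<omega>}" "measure (M n) B > 1 - e"
      using * unfolding inner_prob_def
      by (subst (asm) less_cSup_iff) (auto intro!: bdd_aboveI[of _ 1] exI[of _ "{}"])
    have "measure (M n) (space (M n) - B) < e" using B prob_compl[OF B(1)] by simp
    then show "outer_prob (M n) {\<omega> \<in> space (M n). \<not> E n \<omega>} < e"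
      unfolding outer_prob_less_iff using B by (intro bexI[of _ "space (M n) - B"]) auto
  qed
qed

text \<open>The deterministic bound with the sizes from the four conditions inserted. What matters
  is that the constant depends only on \<open>b\<close>, the number of regressors and the four
  bounds, not on \<open>N\<close>, \<open>T\<close> or \<open>R\<close>.\<close>

lemma LS_rate:
  fixes X :: "nat \<Rightarrow> nat \<Rightarrow> real^'k" and \<beta>h \<beta>0 :: "real^'k"
    and Y \<Gamma> e :: "nat \<Rightarrow> nat \<Rightarrow> real"
  assumes NT: "N > 0" "T > 0" and R: "R \<ge> 1" and b: "b > 0"
    and model: "\<And>i t. i < N \<Longrightarrow> t < T \<Longrightarrow> Y i t = X i t \<bullet> \<beta>0 + \<Gamma> i t + e i t"
    and LS: "LS_obj N T R Y X \<beta>h \<le> LS_obj N T R Y X \<beta>0"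
    and A3: "\<And>\<delta>::real^'k. norm \<delta> = 1 \<Longrightarrow> b \<le> (\<Sum>r\<in>{2 * R + 1..min N T}.
        (sing_val r (to_mat N T (\<lambda>i t. (\<delta> \<bullet> X i t) / sqrt (real N * real T))))\<^sup>2)"
    and G: "(1 / (real N * real T)) * (\<Sum>r\<in>{R + 1..min N T}. (sing_val r (to_mat N T \<Gamma>))\<^sup>2)
        \<le> Cg * real R powr (1 - 2 * \<rho>)"
    and E: "spec_norm (to_mat N T e) \<le> Ce * sqrt (real (max N T))"
    and S: "\<And>k. \<bar>\<Sum>i<N. \<Sum>t<T. X i t $ k * e i t\<bar> \<le> Cs * sqrt (real N * real T)"
    and XX: "\<And>k. (1 / (real N * real T)) * (\<Sum>i<N. \<Sum>t<T. (X i t $ k)\<^sup>2) \<le> Cx"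
    and pos: "Cg > 0" "Ce > 0" "Cs > 0" "Cx > 0"
  shows "norm (\<beta>h - \<beta>0) \<le> (2 * sqrt Cg + 2 * (real CARD('k) * Cs) / sqrt b
            + 2 * sqrt 2 * Ce * (1 + sqrt (real CARD('k) * Cx) / sqrt b)) / sqrt b
         * (real R powr ((3 - 2 * \<rho>) / 2) + real R / sqrt (real (min N T)))"
proof -
  define K where "K = real CARD('k)"
  define s where "s = sqrt (real N * real T)"
  define p where "p = real R powr ((1 - 2 * \<rho>) / 2)"
  define \<mu> where "\<mu> = sqrt (real (min N T))"
  define \<nu> where "\<nu> = sqrt (real (max N T))"
  have s: "s > 0" "s * s = real N * real T" using NT by (simp_all add: s_def)
  have \<mu>: "\<mu> > 0" and \<nu>1: "\<nu> \<ge> 1" using NT by (auto simp: \<mu>_def \<nu>_def)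
  \<comment> \<open>Since N T = min * max, the quotient sqrt(max) / sqrt(N T) becomes 1 /
    sqrt(min).\<close>
  have "real N * real T = real (min N T) * real (max N T)"
    by (simp add: min_def max_def)
  then have \<mu>\<nu>: "s = \<mu> * \<nu>" by (simp add: s_def \<mu>_def \<nu>_def real_sqrt_mult[symmetric])
  have R0: "real R > 0" "real R \<ge> 1" using R by auto
  have pp: "p * p = real R powr (1 - 2 * \<rho>)"
    using powr_add[of "real R" "(1 - 2 * \<rho>) / 2" "(1 - 2 * \<rho>) / 2"] by (simp add: p_def)
  have p: "p \<ge> 0" by (simp add: p_def)
  have b0: "sqrt b > 0" using b by simp
  have "norm (\<beta>h - \<beta>0) * sqrt (b * (real N * real T))
      \<le> 2 * (s * sqrt Cg * p) + 2 * (real CARD('k) * (Cs * s)) / sqrt (b * (real N * real T))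
        + 2 * (sqrt (2 * real R) * (Ce * \<nu>)) * (1 + sqrt (real CARD('k) * (Cx * (real N * real T))) / sqrt (b * (real N * real T)))"
  proof (rule LS_estimation_error_bound[OF NT b model LS A3])
    have "(\<Sum>r\<in>{R + 1..min N T}. (sing_val r (to_mat N T \<Gamma>))\<^sup>2) \<le> Cg * (p * p) * (s * s)"
      using G NT by (simp add: pp s(2) field_simps)
    also have "\<dots> = (s * sqrt Cg * p)\<^sup>2"
      using pos by (simp add: power_mult_distrib power2_eq_square[of s] power2_eq_square[of p])
    finally show "(\<Sum>r\<in>{R + 1..min N T}. (sing_val r (to_mat N T \<Gamma>))\<^sup>2) \<le> (s * sqrt Cg * p)\<^sup>2" .
    show "(\<Sum>i<N. \<Sum>t<T. (X i t $ k)\<^sup>2) \<le> Cx * (real N * real T)" for k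
      using XX[of k] NT by (simp add: field_simps)
  qed (use s pos p E S in \<open>auto simp: s_def \<nu>_def\<close>)
  also have "sqrt (b * (real N * real T)) = sqrt b * s" by (simp add: s_def real_sqrt_mult)
  also have "sqrt (real CARD('k) * (Cx * (real N * real T))) = sqrt (K * Cx) * s"
    by (simp add: s_def K_def real_sqrt_mult)
  also have "sqrt (2 * real R) = sqrt 2 * sqrt (real R)" by (simp add: real_sqrt_mult)
  finally have "norm (\<beta>h - \<beta>0) * (sqrt b * s) \<le> 2 * (s * sqrt Cg * p) + 2 * (K * Cs) / sqrt b
        + 2 * sqrt 2 * Ce * (1 + sqrt (K * Cx) / sqrt b) * (sqrt (real R) * \<nu>)"
    using s(1) by (simp add: K_def mult_ac)
  also have "\<dots> \<le> 2 * sqrt Cg * (s * real R powr ((3 - 2 * \<rho>) / 2)) + 2 * (K * Cs) / sqrt b * (real R * \<nu>)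
        + 2 * sqrt 2 * Ce * (1 + sqrt (K * Cx) / sqrt b) * (real R * \<nu>)"
  \<comment> \<open>Three roundings upwards, permitted by R \<ge> 1 and \<nu> \<ge> 1: the exponent
    (1 - 2\<rho>)/2 to (3 - 2\<rho>)/2, the score factor 1 to R \<nu>, and sqrt(R) to R.\<close>
  proof (intro add_mono)
    have "p \<le> real R powr ((3 - 2 * \<rho>) / 2)"
      unfolding p_def using R0 by (intro powr_mono) auto
    then have "2 * sqrt Cg * (s * p) \<le> 2 * sqrt Cg * (s * real R powr ((3 - 2 * \<rho>) / 2))"
      using s pos by (intro mult_left_mono) auto
    then show "2 * (s * sqrt Cg * p) \<le> 2 * sqrt Cg * (s * real R powr ((3 - 2 * \<rho>) / 2))"
      by (simp add: mult_ac)
    have "1 * 1 \<le> real R * \<nu>" using R0 \<nu>1 by (intro mult_mono) auto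
    then show "2 * (K * Cs) / sqrt b \<le> 2 * (K * Cs) / sqrt b * (real R * \<nu>)"
      using pos b0 mult_left_mono[of 1 "real R * \<nu>" "2 * (K * Cs) / sqrt b"] by (simp add: K_def)
    have "sqrt (real R) \<le> real R"
      using R0 by (intro real_le_lsqrt) (auto simp: power2_eq_square)
    then show "2 * sqrt 2 * Ce * (1 + sqrt (K * Cx) / sqrt b) * (sqrt (real R) * \<nu>)
       \<le> 2 * sqrt 2 * Ce * (1 + sqrt (K * Cx) / sqrt b) * (real R * \<nu>)"
      using pos b0 \<nu>1 by (intro mult_left_mono mult_right_mono) (auto simp: K_def)
  qed
  also have "\<dots> \<le> (2 * sqrt Cg + 2 * (K * Cs) / sqrt b + 2 * sqrt 2 * Ce * (1 + sqrt (K * Cx) / sqrt b))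
      * (s * real R powr ((3 - 2 * \<rho>) / 2) + real R * \<nu>)"
  proof -
    define x y where "x = s * real R powr ((3 - 2 * \<rho>) / 2)" and "y = real R * \<nu>"
    define A B where "A = 2 * sqrt Cg" and "B = 2 * (K * Cs) / sqrt b + 2 * sqrt 2 * Ce * (1 + sqrt (K * Cx) / sqrt b)"
    have "x \<ge> 0" "y \<ge> 0" "A \<ge> 0" "B \<ge> 0"
      using s pos b0 \<nu>1 by (auto simp: x_def y_def A_def B_def K_def)
    then have "A * x + B * y \<le> (A + B) * (x + y)" by (simp add: algebra_simps)
    then show ?thesis by (simp add: x_def y_def A_def B_def algebra_simps)
  qed
  also have "s * real R powr ((3 - 2 * \<rho>) / 2) + real R * \<nu> = s * (real R powr ((3 - 2 * \<rho>) / 2) + real R / \<mu>)"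
    using \<mu> by (simp add: \<mu>\<nu> field_simps)
  finally have "norm (\<beta>h - \<beta>0) * (sqrt b * s) \<le> (2 * sqrt Cg + 2 * (K * Cs) / sqrt b + 2 * sqrt 2 * Ce * (1 + sqrt (K * Cx) / sqrt b))
      * (s * (real R powr ((3 - 2 * \<rho>) / 2) + real R / \<mu>))" .
  then have "norm (\<beta>h - \<beta>0) * sqrt b \<le> (2 * sqrt Cg + 2 * (K * Cs) / sqrt b + 2 * sqrt 2 * Ce * (1 + sqrt (K * Cx) / sqrt b))
      * (real R powr ((3 - 2 * \<rho>) / 2) + real R / \<mu>)"
    using s(1) by (simp add: mult.assoc[symmetric] mult.commute[of _ s]) 
  then have "norm (\<beta>h - \<beta>0) \<le> (2 * sqrt Cg + 2 * (K * Cs) / sqrt b + 2 * sqrt 2 * Ce * (1 + sqrt (K * Cx) / sqrt b))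
      * (real R powr ((3 - 2 * \<rho>) / 2) + real R / \<mu>) / sqrt b"
    using b0 by (simp only: pos_le_divide_eq)
  then show ?thesis by (simp only: K_def \<mu>_def times_divide_eq_left)
qed

lemma bigO_P_mono:
  assumes prob: "\<And>n. prob_space (M n)" and Z: "bigO_P F M Z a" and a: "\<And>n. a n \<ge> 0"
    and le: "eventually (\<lambda>n. a n \<le> D * a' n) F"
  shows "bigO_P F M Z a'"
  unfolding bigO_P_def
proof (intro allI impI)
  fix e :: real assume e: "e > 0"
  obtain C where C: "C > 0"
    "eventually (\<lambda>n. outer_prob (M n) {\<omega> \<in> space (M n). \<not> \<bar>Z n \<omega>\<bar> \<le> C * a n} < e) F"
    by (rule bigO_P_bounded[OF prob Z a e])
  show "\<exists>C. eventually (\<lambda>n. outer_prob (M n) {\<omega> \<in> space (M n). \<bar>Z n \<omega>\<bar> > C * a' n} < e) F"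
  proof (rule exI[of _ "C * D"], use C(2) le in eventually_elim)
    fix n assume *: "outer_prob (M n) {\<omega> \<in> space (M n). \<not> \<bar>Z n \<omega>\<bar> \<le> C * a n} < e" "a n \<le> D * a' n"
    interpret prob_space "M n" by (rule prob)
    have "C * a n \<le> C * D * a' n" using mult_left_mono[OF *(2), of C] C(1) by (simp add: mult.assoc)
    then show "outer_prob (M n) {\<omega> \<in> space (M n). \<bar>Z n \<omega>\<bar> > C * D * a' n} < e"
      by (intro outer_prob_less_mono[OF *(1)]) auto
  qed
qed

text \<open>The exponent \<gamma> = 1/(2\<rho> - 1) solves \<gamma> (3 - 2\<rho>)/2 = \<gamma> -
  1/2, so both terms have the same order. As 3 - 2\<rho> is negative, the first term is controlled
  by the lower bound on r and the second by the upper bound.\<close>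

lemma balanced_rate:
  fixes m r \<rho> :: real
  assumes \<rho>: "\<rho> > 3 / 2" and m: "m > 0" and c: "c1 > 0"
    and lower: "c1 * m powr (1 / (2 * \<rho> - 1)) \<le> r"
    and upper: "r \<le> c2 * m powr (1 / (2 * \<rho> - 1))"
  shows "r powr ((3 - 2 * \<rho>) / 2) + r / sqrt m
     \<le> (c1 powr ((3 - 2 * \<rho>) / 2) + c2) * m powr ((3 - 2 * \<rho>) / (2 * (2 * \<rho> - 1)))"
proof -
  define \<gamma> where "\<gamma> = 1 / (2 * \<rho> - 1)"
  have e1: "\<gamma> * ((3 - 2 * \<rho>) / 2) = (3 - 2 * \<rho>) / (2 * (2 * \<rho> - 1))"
    and e2: "\<gamma> - 1 / 2 = (3 - 2 * \<rho>) / (2 * (2 * \<rho> - 1))"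
    using \<rho> by (simp_all add: \<gamma>_def field_simps)
  have "r powr ((3 - 2 * \<rho>) / 2) \<le> (c1 * m powr \<gamma>) powr ((3 - 2 * \<rho>) / 2)"
    using \<rho> m c lower by (intro powr_mono2') (auto simp: \<gamma>_def)
  also have "\<dots> = c1 powr ((3 - 2 * \<rho>) / 2) * m powr ((3 - 2 * \<rho>) / (2 * (2 * \<rho> - 1)))"
    using c by (simp only: powr_mult powr_powr e1)
  finally have 1: "r powr ((3 - 2 * \<rho>) / 2) \<le> c1 powr ((3 - 2 * \<rho>) / 2) * m powr ((3 - 2 * \<rho>) / (2 * (2 * \<rho> - 1)))" .
  have "r / sqrt m \<le> c2 * m powr \<gamma> / sqrt m"
    using upper m by (intro divide_right_mono) (auto simp: \<gamma>_def)
  also have "\<dots> = c2 * m powr ((3 - 2 * \<rho>) / (2 * (2 * \<rho> - 1)))"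
    unfolding e2[symmetric] powr_diff using m by (simp add: powr_half_sqrt)
  finally show ?thesis using 1 by (simp add: distrib_right)
qed

theorem theorem1:
  fixes M :: "'i \<Rightarrow> 'a measure" and F :: "'i filter"
    and N T R :: "'i \<Rightarrow> nat"
    and X :: "'i \<Rightarrow> 'a \<Rightarrow> nat \<Rightarrow> nat \<Rightarrow> real^'k"
    and Y \<Gamma> \<epsilon> :: "'i \<Rightarrow> 'a \<Rightarrow> nat \<Rightarrow> nat \<Rightarrow> real"
    and \<beta>0 :: "real^'k"
    and \<beta>hat :: "'i \<Rightarrow> 'a \<Rightarrow> real^'k"
    and \<rho> :: real
  assumes prob: "\<And>n. prob_space (M n)"
    and N_lim: "filterlim N at_top F"
    and T_lim: "filterlim T at_top F"
    and R_pos: "\<And>n. R n \<ge> 1"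
    and model: "\<And>n \<omega> i t. \<omega> \<in> space (M n) \<Longrightarrow> i < N n \<Longrightarrow> t < T n \<Longrightarrow>
                 Y n \<omega> i t = X n \<omega> i t \<bullet> \<beta>0 + \<Gamma> n \<omega> i t + \<epsilon> n \<omega> i t"
    and LS: "\<And>n \<omega> \<beta>. \<omega> \<in> space (M n) \<Longrightarrow>
               LS_obj (N n) (T n) (R n) (Y n \<omega>) (X n \<omega>) (\<beta>hat n \<omega>)
                 \<le> LS_obj (N n) (T n) (R n) (Y n \<omega>) (X n \<omega>) \<beta>"
    and A1X: "\<And>k. bigO_P F M
               (\<lambda>n \<omega>. (1 / (real (N n) * real (T n))) *
                  (\<Sum>i<N n. \<Sum>t<T n. (X n \<omega> i t $ k)\<^sup>2)) (\<lambda>n. 1)"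
    and A1e: "bigO_P F M (\<lambda>n \<omega>. spec_norm (to_mat (N n) (T n) (\<epsilon> n \<omega>)))
               (\<lambda>n. sqrt (real (max (N n) (T n))))"
    and A2: "\<And>k. bigO_P F M
               (\<lambda>n \<omega>. \<Sum>i<N n. \<Sum>t<T n. (X n \<omega> i t $ k) * \<epsilon> n \<omega> i t)
               (\<lambda>n. sqrt (real (N n) * real (T n)))"
    and A3: "\<exists>b>0. wpa1 F M (\<lambda>n \<omega>. \<forall>\<delta>::real^'k. norm \<delta> = 1 \<longrightarrow>
               (\<Sum>r\<in>{2 * R n + 1 .. min (N n) (T n)}.
                  (sing_val r (to_mat (N n) (T n)
                     (\<lambda>i t. (\<delta> \<bullet> X n \<omega> i t) / sqrt (real (N n) * real (T n)))))\<^sup>2) \<ge> b)"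
    and rho: "\<rho> > 3 / 2"
    and A4: "bigO_P F M
               (\<lambda>n \<omega>. (1 / (real (N n) * real (T n))) *
                  (\<Sum>r\<in>{R n + 1 .. min (N n) (T n)}.
                     (sing_val r (to_mat (N n) (T n) (\<Gamma> n \<omega>)))\<^sup>2))
               (\<lambda>n. real (R n) powr (1 - 2 * \<rho>))"
    and R_small: "(\<lambda>n. real (R n)) \<in> o[F](\<lambda>n. real (min (N n) (T n)))"
  shows "bigO_P F M (\<lambda>n \<omega>. norm (\<beta>hat n \<omega> - \<beta>0))
           (\<lambda>n. real (R n) powr ((3 - 2 * \<rho>) / 2)
                 + real (R n) / sqrt (real (min (N n) (T n))))
       \<and> ((\<exists>c1>0. \<exists>c2>0. eventually (\<lambda>n.
              c1 * real (min (N n) (T n)) powr (1 / (2 * \<rho> - 1)) \<le> real (R n) \<and>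
              real (R n) \<le> c2 * real (min (N n) (T n)) powr (1 / (2 * \<rho> - 1))) F)
          \<longrightarrow> bigO_P F M (\<lambda>n \<omega>. norm (\<beta>hat n \<omega> - \<beta>0))
                (\<lambda>n. real (min (N n) (T n)) powr ((3 - 2 * \<rho>) / (2 * (2 * \<rho> - 1)))))"
proof -
  define rate where "rate n = real (R n) powr ((3 - 2 * \<rho>) / 2)
                 + real (R n) / sqrt (real (min (N n) (T n)))" for n
  have rate0: "rate n \<ge> 0" for n by (simp add: rate_def)
  obtain b where b: "b > 0" and A3: "wpa1 F M (\<lambda>n \<omega>. \<forall>\<delta>::real^'k. norm \<delta> = 1 \<longrightarrow>
               (\<Sum>r\<in>{2 * R n + 1 .. min (N n) (T n)}.
                  (sing_val r (to_mat (N n) (T n)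
                     (\<lambda>i t. (\<delta> \<bullet> X n \<omega> i t) / sqrt (real (N n) * real (T n)))))\<^sup>2) \<ge> b)"
    using A3 by blast
  have N_pos: "eventually (\<lambda>n. N n > 0) F" and T_pos: "eventually (\<lambda>n. T n > 0) F"
    using N_lim[unfolded filterlim_at_top, rule_format, of 1] T_lim[unfolded filterlim_at_top, rule_format, of 1]
    by (simp_all add: Suc_le_eq)
  have main: "bigO_P F M (\<lambda>n \<omega>. norm (\<beta>hat n \<omega> - \<beta>0)) rate"
    unfolding bigO_P_def
  proof (intro allI impI)
    fix eps :: real assume "eps > 0"
    \<comment> \<open>One fifth for each exceptional set: two from condition (1), one each from (2),
      (3) and (4).\<close>
    then have e: "eps / 5 > 0" by simp
    obtain Cx where Cx: "Cx > 0" and ev1: "eventually (\<lambda>n. outer_prob (M n) {\<omega> \<in> space (M n).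
        \<not> (\<forall>k. \<bar>(1 / (real (N n) * real (T n))) * (\<Sum>i<N n. \<Sum>t<T n. (X n \<omega> i t $ k)\<^sup>2)\<bar> \<le> Cx * 1)} < eps / 5) F"
      by (rule bigO_P_bounded_finite[OF prob A1X _ e]) auto
    obtain Ce where Ce: "Ce > 0" and ev2: "eventually (\<lambda>n. outer_prob (M n) {\<omega> \<in> space (M n).
        \<not> \<bar>spec_norm (to_mat (N n) (T n) (\<epsilon> n \<omega>))\<bar> \<le> Ce * sqrt (real (max (N n) (T n)))} < eps / 5) F"
      by (rule bigO_P_bounded[OF prob A1e _ e]) auto
    obtain Cs where Cs: "Cs > 0" and ev3: "eventually (\<lambda>n. outer_prob (M n) {\<omega> \<in> space (M n).
        \<not> (\<forall>k. \<bar>\<Sum>i<N n. \<Sum>t<T n. X n \<omega> i t $ k * \<epsilon> n \<omega> i t\<bar> \<le> Cs * sqrt (real (N n) * real (T n)))} < eps / 5) F"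
      by (rule bigO_P_bounded_finite[OF prob A2 _ e]) auto
    obtain Cg where Cg: "Cg > 0" and ev4: "eventually (\<lambda>n. outer_prob (M n) {\<omega> \<in> space (M n).
        \<not> \<bar>(1 / (real (N n) * real (T n))) * (\<Sum>r\<in>{R n + 1 .. min (N n) (T n)}.
                     (sing_val r (to_mat (N n) (T n) (\<Gamma> n \<omega>)))\<^sup>2)\<bar> \<le> Cg * real (R n) powr (1 - 2 * \<rho>)} < eps / 5) F"
      by (rule bigO_P_bounded[OF prob A4 _ e]) auto
    note ev5 = wpa1_outer_prob_less[OF prob A3 e]
    \<comment> \<open>The constant of \<open>LS_rate\<close>; it depends on \<open>eps\<close>
      through the four bounds but is fixed before \<open>n\<close>.\<close>
    define C where "C = (2 * sqrt Cg + 2 * (real CARD('k) * Cs) / sqrt b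
            + 2 * sqrt 2 * Ce * (1 + sqrt (real CARD('k) * Cx) / sqrt b)) / sqrt b"
    show "\<exists>C. eventually (\<lambda>n. outer_prob (M n) {\<omega> \<in> space (M n). \<bar>norm (\<beta>hat n \<omega> - \<beta>0)\<bar> > C * rate n} < eps) F"
    proof (rule exI[of _ C], use N_pos T_pos ev1 ev2 ev3 ev4 ev5 in eventually_elim)
      case (elim n)
      interpret prob_space "M n" by (rule prob)
      let ?A1 = "{\<omega> \<in> space (M n). \<not> (\<forall>k. \<bar>(1 / (real (N n) * real (T n))) * (\<Sum>i<N n. \<Sum>t<T n. (X n \<omega> i t $ k)\<^sup>2)\<bar> \<le> Cx * 1)}"
      let ?A2 = "{\<omega> \<in> space (M n). \<not> \<bar>spec_norm (to_mat (N n) (T n) (\<epsilon> n \<omega>))\<bar> \<le> Ce * sqrt (real (max (N n) (T n)))}"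
      let ?A3 = "{\<omega> \<in> space (M n). \<not> (\<forall>k. \<bar>\<Sum>i<N n. \<Sum>t<T n. X n \<omega> i t $ k * \<epsilon> n \<omega> i t\<bar> \<le> Cs * sqrt (real (N n) * real (T n)))}"
      let ?A4 = "{\<omega> \<in> space (M n). \<not> \<bar>(1 / (real (N n) * real (T n))) * (\<Sum>r\<in>{R n + 1 .. min (N n) (T n)}.
                     (sing_val r (to_mat (N n) (T n) (\<Gamma> n \<omega>)))\<^sup>2)\<bar> \<le> Cg * real (R n) powr (1 - 2 * \<rho>)}"
      let ?A5 = "{\<omega> \<in> space (M n). \<not> (\<forall>\<delta>::real^'k. norm \<delta> = 1 \<longrightarrow>
               (\<Sum>r\<in>{2 * R n + 1 .. min (N n) (T n)}.
                  (sing_val r (to_mat (N n) (T n)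
                     (\<lambda>i t. (\<delta> \<bullet> X n \<omega> i t) / sqrt (real (N n) * real (T n)))))\<^sup>2) \<ge> b)}"
      have "outer_prob (M n) (?A1 \<union> (?A2 \<union> (?A3 \<union> (?A4 \<union> ?A5)))) < eps / 5 + (eps / 5 + (eps / 5 + (eps / 5 + eps / 5)))"
        using elim by (intro outer_prob_Un_less)
      also have "\<dots> = eps" by simp
      finally have U: "outer_prob (M n) (?A1 \<union> (?A2 \<union> (?A3 \<union> (?A4 \<union> ?A5)))) < eps" .
      show ?case
      \<comment> \<open>Off the union, every hypothesis of the deterministic bound holds at
        \<omega>, so the event of a large error lies inside the union.\<close>
      proof (rule outer_prob_less_mono[OF U], rule subsetI, rule ccontr)
        fix \<omega> assume "\<omega> \<in> {\<omega> \<in> space (M n). \<bar>norm (\<beta>hat n \<omega> - \<beta>0)\<bar> > C * rate n} \<inter> space (M n)"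
        then have \<omega>: "\<omega> \<in> space (M n)" and big: "norm (\<beta>hat n \<omega> - \<beta>0) > C * rate n" by auto
        assume good: "\<omega> \<notin> ?A1 \<union> (?A2 \<union> (?A3 \<union> (?A4 \<union> ?A5)))"
        have g1: "\<bar>(1 / (real (N n) * real (T n))) * (\<Sum>i<N n. \<Sum>t<T n. (X n \<omega> i t $ k)\<^sup>2)\<bar> \<le> Cx * 1" for k
          using good \<omega> by blast
        have g2: "\<bar>spec_norm (to_mat (N n) (T n) (\<epsilon> n \<omega>))\<bar> \<le> Ce * sqrt (real (max (N n) (T n)))"
          using good \<omega> by blast
        have g3: "\<bar>\<Sum>i<N n. \<Sum>t<T n. X n \<omega> i t $ k * \<epsilon> n \<omega> i t\<bar> \<le> Cs * sqrt (real (N n) * real (T n))" for k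
          using good \<omega> by blast
        have g4: "\<bar>(1 / (real (N n) * real (T n))) * (\<Sum>r\<in>{R n + 1 .. min (N n) (T n)}.
                     (sing_val r (to_mat (N n) (T n) (\<Gamma> n \<omega>)))\<^sup>2)\<bar> \<le> Cg * real (R n) powr (1 - 2 * \<rho>)"
          using good \<omega> by blast
        have g5: "b \<le> (\<Sum>r\<in>{2 * R n + 1 .. min (N n) (T n)}.
                  (sing_val r (to_mat (N n) (T n)
                     (\<lambda>i t. (\<delta> \<bullet> X n \<omega> i t) / sqrt (real (N n) * real (T n)))))\<^sup>2)" if "norm \<delta> = 1" for \<delta> :: "real^'k"
          using good \<omega> that by blast
        have "norm (\<beta>hat n \<omega> - \<beta>0) \<le> C * rate n"
          unfolding C_def rate_def
          by (rule LS_rate[OF elim(1,2) R_pos b model[OF \<omega>] LS[OF \<omega>] g5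
                order_trans[OF abs_ge_self g4] order_trans[OF abs_ge_self g2] g3
                order_trans[OF abs_ge_self g1, unfolded mult_1_right] Cg Ce Cs Cx])
        with big show False by simp
      qed
    qed
  qed
  moreover have "bigO_P F M (\<lambda>n \<omega>. norm (\<beta>hat n \<omega> - \<beta>0))
      (\<lambda>n. real (min (N n) (T n)) powr ((3 - 2 * \<rho>) / (2 * (2 * \<rho> - 1))))"
    if "c1 > 0" "c2 > 0" and ev: "eventually (\<lambda>n.
              c1 * real (min (N n) (T n)) powr (1 / (2 * \<rho> - 1)) \<le> real (R n) \<and>
              real (R n) \<le> c2 * real (min (N n) (T n)) powr (1 / (2 * \<rho> - 1))) F" for c1 c2
  proof (rule bigO_P_mono[OF prob main rate0])
    show "eventually (\<lambda>n. rate n \<le> (c1 powr ((3 - 2 * \<rho>) / 2) + c2)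
        * real (min (N n) (T n)) powr ((3 - 2 * \<rho>) / (2 * (2 * \<rho> - 1)))) F"
      using N_pos T_pos ev
    proof eventually_elim
      case (elim n)
      then show ?case
        unfolding rate_def using rho \<open>c1 > 0\<close> by (intro balanced_rate) auto
    qed
  qed
  ultimately show ?thesis unfolding rate_def by blast
qed

end
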